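(* Let $H_1,\ldots,H_n$ ($n\ge 2$) be (closed) subspaces of a complex Hilbert space $H$. Then there exist (closed) subspaces $M_j\subset H_j$, $2\le j\le n$, such that: (1) $H_1,M_2,\ldots,M_n$ are linearly independent; (2) $H_1+M_2+\ldots+M_n=H_1+\ldots+H_n$.
   Context: "Subspace" means closed linear subspace; sums of subspaces are algebraic sums and are not assumed to be closed. Subspaces $X_1,\ldots,X_n$ are called linearly independent if $\sum_{j=1}^n x_j=0$ with $x_j\in X_j$ for $1\le j\le n$ implies $x_1=\ldots=x_n=0$. No restriction is imposed on the dimension of $H$. *)

theory Defs
  imports "HOL-Analysis.Analysis" "HOL-Library.Set_Algebras"
begin

text \<open>
  A complex inner product space is presented on top of its underlying real inner product space,
  whose inner product is the real part of the complex one. Hence norm, metric and topology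
  are the library's, and positive definiteness of the complex inner product is inherited
  (see \<open>cinner_same\<close> below). The complex inner product is linear in its first argument.
\<close>

class complex_inner = real_inner +
  fixes scaleC :: "complex \<Rightarrow> 'a \<Rightarrow> 'a"  (infixr "*\<^sub>C" 75)
    and cinner :: "'a \<Rightarrow> 'a \<Rightarrow> complex"
  assumes scaleC_add_right: "a *\<^sub>C (x + y) = a *\<^sub>C x + a *\<^sub>C y"
    and scaleC_add_left: "(a + b) *\<^sub>C x = a *\<^sub>C x + b *\<^sub>C x"
    and scaleC_scaleC: "a *\<^sub>C b *\<^sub>C x = (a * b) *\<^sub>C x"
    and scaleC_one: "1 *\<^sub>C x = x"
    and scaleC_of_real: "complex_of_real r *\<^sub>C x = r *\<^sub>R x"
    and cinner_commute: "cinner x y = cnj (cinner y x)"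
    and cinner_add_left: "cinner (x + y) z = cinner x z + cinner y z"
    and cinner_scaleC_left: "cinner (a *\<^sub>C x) y = a * cinner x y"
    and Re_cinner: "Re (cinner x y) = inner x y"

class complex_hilbert_space = complex_inner + complete_space

global_interpretation complex_vector:
  vector_space "scaleC :: complex \<Rightarrow> 'a \<Rightarrow> 'a::complex_inner"
  by unfold_locales
    (simp_all add: scaleC_add_right scaleC_add_left scaleC_scaleC scaleC_one)

lemma cinner_same:
  fixes x :: "'a::complex_inner"
  shows "cinner x x = complex_of_real ((norm x)\<^sup>2)"
proof (rule complex_eqI)
  show "Re (cinner x x) = Re (complex_of_real ((norm x)\<^sup>2))"
    by (simp add: Re_cinner power2_norm_eq_inner)
  have "Im (cinner x x) = - Im (cinner x x)"
    using arg_cong[OF cinner_commute[of x x], of Im] by simp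
  then show "Im (cinner x x) = Im (complex_of_real ((norm x)\<^sup>2))"
    by simp
qed

definition closed_csubspace :: "'a::complex_inner set \<Rightarrow> bool"
  where "closed_csubspace S \<longleftrightarrow> complex_vector.subspace S \<and> closed S"

definition independent_subspaces :: "'i set \<Rightarrow> ('i \<Rightarrow> 'a::complex_inner set) \<Rightarrow> bool"
  where "independent_subspaces I X \<longleftrightarrow>
    (\<forall>x. (\<forall>j\<in>I. x j \<in> X j) \<and> (\<Sum>j\<in>I. x j) = 0 \<longrightarrow> (\<forall>j\<in>I. x j = 0))"

text \<open>
  Sums of subspaces are the Minkowski sums \<open>A + B\<close> and \<open>\<Sum>j\<in>I. X j\<close>
  on sets from \<^theory>\<open>HOL-Library.Set_Algebras\<close>; no closure is taken.
\<close>

end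

theory Submission
  imports Defs
begin

text \<open>
  In the Hilbert sum \<open>E\<close> of \<open>H\<^sub>2, \<dots>, H\<^sub>n\<close>, the tuples whose entries add up to an element of \<open>H\<^sub>1\<close> form a
  closed subspace \<open>N\<close>, and it suffices to find closed \<open>M\<^sub>j \<subseteq> H\<^sub>j\<close> whose Hilbert sum is an algebraic
  complement of \<open>N\<close> in \<open>E\<close>.

  For two orthogonal summands \<open>E = E\<^sub>1 + E\<^sub>2\<close> with projections \<open>Q\<^sub>1, Q\<^sub>2\<close>, split \<open>N = A + B\<close> along the sign of
  the compression of \<open>Q\<^sub>1 - Q\<^sub>2\<close> to \<open>N\<close>. Then \<open>Q\<^sub>1\<close> is bounded below on \<open>A\<close> and \<open>Q\<^sub>2\<close> on \<open>B\<close>, while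
  \<open>Q\<^sub>1 A \<bottom> Q\<^sub>1 B\<close> and \<open>Q\<^sub>2 A \<bottom> Q\<^sub>2 B\<close>, so \<open>M\<^sub>1 = E\<^sub>1 \<ominus> Q\<^sub>1 A\<close> and \<open>M\<^sub>2 = E\<^sub>2 \<ominus> Q\<^sub>2 B\<close> work.

  For more summands, apply this to \<open>E = E\<^sub>1 + E'\<close> with \<open>E'\<close> the sum of the others. This gives
  \<open>M\<^sub>1\<close> and \<open>M'\<close>; by the modular law \<open>(N + M\<^sub>1) \<inter> E'\<close> is a closed complement of \<open>M'\<close> in \<open>E'\<close>, so \<open>M'\<close> can be
  replaced by a sum of coordinate subspaces that complements \<open>(N + M\<^sub>1) \<inter> E'\<close>.
\<close>

section \<open>Complete complex subspaces\<close>

text \<open>Completeness replaces closedness because the ambient space built below, the finitely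
  supported sequences, is not complete. In a Hilbert space this notion and
  \<open>closed_csubspace\<close> agree.\<close>

definition complete_csubspace :: "'a::complex_inner set \<Rightarrow> bool"
  where "complete_csubspace S \<longleftrightarrow> complex_vector.subspace S \<and> complete S"

lemma csubspace_imp_subspace:
  assumes "complex_vector.subspace S"
  shows "subspace S"
  unfolding subspace_def
proof (intro conjI ballI allI)
  show "0 \<in> S" using assms by (rule complex_vector.subspace_0)
  show "x + y \<in> S" if "x \<in> S" "y \<in> S" for x y
    using assms that by (rule complex_vector.subspace_add)
  show "c *\<^sub>R x \<in> S" if "x \<in> S" for c x
    using complex_vector.subspace_scale[OF assms that, of "complex_of_real c"]
    by (simp add: scaleC_of_real)
qed

text \<open>The adjoint of multiplication by \<open>c\<close> for the real inner product is
  multiplication by \<open>cnj c\<close>. This links the library's real orthogonality to the complex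
  structure.\<close>

lemma inner_scaleC_left: "inner (c *\<^sub>C x) y = inner x (cnj c *\<^sub>C y)"
proof -
  have "cinner x (cnj c *\<^sub>C y) = cnj (cinner (cnj c *\<^sub>C y) x)"
    by (rule cinner_commute)
  also have "\<dots> = c * cinner x y"
    by (simp add: cinner_scaleC_left cinner_commute[of x y])
  finally show ?thesis
    by (simp add: cinner_scaleC_left flip: Re_cinner)
qed

lemma norm_scaleC: "norm (c *\<^sub>C x) = cmod c * norm x"
proof -
  have "(norm (c *\<^sub>C x))\<^sup>2 = inner x ((cnj c * c) *\<^sub>C x)"
    by (simp add: power2_norm_eq_inner inner_scaleC_left scaleC_scaleC)
  also have "cnj c * c = complex_of_real ((cmod c)\<^sup>2)"
    by (simp only: complex_norm_square mult.commute)
  also have "inner x (\<dots> *\<^sub>C x) = (cmod c * norm x)\<^sup>2"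
    by (simp add: scaleC_of_real power2_norm_eq_inner power_mult_distrib del: of_real_power)
  finally show ?thesis by simp
qed

lemma bounded_linear_scaleC: "bounded_linear (\<lambda>x. c *\<^sub>C x)"
proof (rule bounded_linear_intro)
  show "c *\<^sub>C (x + y) = c *\<^sub>C x + c *\<^sub>C y" for x y :: 'a
    by (rule scaleC_add_right)
  show "c *\<^sub>C (r *\<^sub>R x) = r *\<^sub>R (c *\<^sub>C x)" for r and x :: 'a
    by (simp add: scaleC_scaleC mult.commute flip: scaleC_of_real)
  show "norm (c *\<^sub>C x) \<le> norm x * cmod c" for x :: 'a
    by (simp add: norm_scaleC mult.commute)
qed

text \<open>The complement is taken for the real inner product; it is closed under complex scaling
  because the scalar can be moved onto \<open>S\<close>, which absorbs it.\<close>

lemma csubspace_orthogonal_comp: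
  assumes "complex_vector.subspace S"
  shows "complex_vector.subspace (orthogonal_comp S)"
  unfolding complex_vector.subspace_def orthogonal_comp_def orthogonal_def
proof (intro conjI ballI allI CollectI)
  fix c x y assume x: "x \<in> {x. \<forall>y\<in>S. inner y x = 0}" and y: "y \<in> S"
  have "cnj c *\<^sub>C y \<in> S" using assms y by (rule complex_vector.subspace_scale)
  then have "inner (cnj c *\<^sub>C y) x = 0" using x by blast
  then show "inner y (c *\<^sub>C x) = 0" by (simp add: inner_scaleC_left)
qed (auto simp: inner_right_distrib)

lemma closed_orthogonal_comp:
  "closed (orthogonal_comp S)"
proof -
  have "orthogonal_comp S = (\<Inter>y\<in>S. {x. inner y x = 0})"
    by (auto simp: orthogonal_comp_def orthogonal_def)
  then show ?thesis
    by (auto intro!: closed_INT closed_Collect_eq continuous_intros)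
qed

lemma complete_csubspace_Int:
  assumes "complete_csubspace S" "complex_vector.subspace T" "closed T"
  shows "complete_csubspace (S \<inter> T)"
  using assms by (simp add: complete_csubspace_def complex_vector.subspace_inter complete_Int_closed)

lemma complete_csubspace_orthogonal_comp_Int:
  assumes "complete_csubspace S" "complex_vector.subspace T"
  shows "complete_csubspace (S \<inter> orthogonal_comp T)"
  by (intro complete_csubspace_Int csubspace_orthogonal_comp closed_orthogonal_comp assms)

section \<open>Orthogonal decomposition along a complete subspace\<close>

lemma parallelogram_law:
  fixes x y :: "'a::real_inner"
  shows "(norm (x + y))\<^sup>2 + (norm (x - y))\<^sup>2 = 2 * (norm x)\<^sup>2 + 2 * (norm y)\<^sup>2"
  by (simp add: power2_norm_eq_inner inner_simps inner_commute)

text \<open>The point of \<open>S\<close> nearest to \<open>x\<close> is the limit of a minimizing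
  sequence, which is Cauchy by the parallelogram law. The limit exists since \<open>S\<close> is
  complete, whether or not the ambient space is.\<close>

lemma orthogonal_decomposition:
  fixes S :: "'a::real_inner set"
  assumes S: "subspace S" "complete S"
  shows "\<exists>p\<in>S. x - p \<in> orthogonal_comp S"
proof -
  define d where "d = (INF y\<in>S. (norm (x - y))\<^sup>2)"
  have ne: "S \<noteq> {}" using S(1) subspace_0 by blast
  have bdd: "bdd_below ((\<lambda>y. (norm (x - y))\<^sup>2) ` S)"
    by (rule bdd_belowI[of _ 0]) auto
  have d_le: "d \<le> (norm (x - y))\<^sup>2" if "y \<in> S" for y
    unfolding d_def by (rule cINF_lower[OF bdd that])
  have "\<exists>y\<in>S. (norm (x - y))\<^sup>2 < d + inverse (real (Suc k))" for k
    using cINF_less_iff[OF ne bdd, of "d + inverse (real (Suc k))"]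
    by (simp add: d_def)
  then obtain u where u: "\<And>k. u k \<in> S" "\<And>k. (norm (x - u k))\<^sup>2 < d + inverse (real (Suc k))"
    by metis
  \<comment> \<open>The midpoint of \<open>u j\<close> and \<open>u k\<close> lies in
    \<open>S\<close>, so its squared distance to \<open>x\<close> is at least \<open>d\<close>; the
    parallelogram law turns this into a bound on \<open>u j - u k\<close>.\<close>
  have key: "(norm (u j - u k))\<^sup>2 \<le> 2 * inverse (real (Suc j)) + 2 * inverse (real (Suc k))" for j k
  proof -
    have "(1/2) *\<^sub>R (u j + u k) \<in> S"
      using u(1) S(1) by (simp add: subspace_add subspace_scale)
    then have "4 * d \<le> 4 * (norm (x - (1/2) *\<^sub>R (u j + u k)))\<^sup>2"
      using d_le by simp
    also have "\<dots> = (norm (2 *\<^sub>R (x - (1/2) *\<^sub>R (u j + u k))))\<^sup>2"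
      by (simp only: norm_scaleR power_mult_distrib) simp
    also have "2 *\<^sub>R (x - (1/2) *\<^sub>R (u j + u k)) = (x - u j) + (x - u k)"
      by (simp add: algebra_simps scaleR_2)
    finally have "4 * d \<le> (norm ((x - u j) + (x - u k)))\<^sup>2" .
    moreover have "(x - u j) - (x - u k) = - (u j - u k)" by simp
    ultimately show ?thesis
      using parallelogram_law[of "x - u j" "x - u k"] u(2)[of j] u(2)[of k]
      by (simp only: norm_minus_cancel)
  qed
  have "Cauchy u"
  proof (rule metric_CauchyI)
    fix e :: real assume e: "0 < e"
    then obtain M where M: "inverse (real (Suc M)) < e\<^sup>2 / 4"
      using reals_Archimedean[of "e\<^sup>2/4"] by auto
    have "dist (u j) (u k) < e" if "j \<ge> M" "k \<ge> M" for j k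
    proof -
      have "inverse (real (Suc j)) \<le> inverse (real (Suc M))" "inverse (real (Suc k)) \<le> inverse (real (Suc M))"
        using that by (simp_all add: field_simps)
      then have "(norm (u j - u k))\<^sup>2 < e\<^sup>2" using key[of j k] M by linarith
      then show ?thesis using e by (simp add: dist_norm power_less_imp_less_base)
    qed
    then show "\<exists>M. \<forall>m\<ge>M. \<forall>n\<ge>M. dist (u m) (u n) < e" by blast
  qed
  then obtain p where p: "p \<in> S" "u \<longlonglongrightarrow> p"
    using S(2) u(1) unfolding complete_def by blast
  have "(\<lambda>k. (norm (x - u k))\<^sup>2) \<longlonglongrightarrow> (norm (x - p))\<^sup>2"
    by (intro tendsto_intros p)
  moreover have "(\<lambda>k. d + inverse (real (Suc k))) \<longlonglongrightarrow> d + 0"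
    by (intro tendsto_intros LIMSEQ_inverse_real_of_nat)
  ultimately have pd: "(norm (x - p))\<^sup>2 \<le> d"
    using u(2) by (intro LIMSEQ_le[of _ _ "\<lambda>k. d + inverse (real (Suc k))" d]) (auto intro: less_imp_le)
  have "inner y (x - p) = 0" if y: "y \<in> S" for y
  proof (rule ccontr)
    define i where "i = inner y (x - p)"
    assume "inner y (x - p) \<noteq> 0"
    then have i: "i \<noteq> 0" and "y \<noteq> 0" by (auto simp: i_def)
    then have ny: "inner y y > 0" by simp
    \<comment> \<open>This \<open>t\<close> minimizes the quadratic
      \<open>(norm (x - p - t *\<^sub>R y))\<^sup>2\<close>, lowering its value at 0 by
      \<open>i\<^sup>2 / inner y y\<close>, which contradicts minimality.\<close>
    define t where "t = i / inner y y"
    have "p + t *\<^sub>R y \<in> S" using S(1) p(1) y by (simp add: subspace_add subspace_scale)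
    then have "(norm (x - p))\<^sup>2 \<le> (norm (x - (p + t *\<^sub>R y)))\<^sup>2"
      using pd d_le order_trans by blast
    also have "x - (p + t *\<^sub>R y) = (x - p) - t *\<^sub>R y" by simp
    also have "(norm \<dots>)\<^sup>2 = (norm (x - p))\<^sup>2 - 2 * t * i + t\<^sup>2 * inner y y"
    proof -
      have "(norm (w - t *\<^sub>R y))\<^sup>2 = (norm w)\<^sup>2 - 2 * t * inner y w + t\<^sup>2 * inner y y" for w
        using inner_commute[of w y]
        unfolding power2_norm_eq_inner
        by (simp add: inner_diff_left inner_diff_right power2_eq_square algebra_simps)
      then show ?thesis by (simp only: i_def)
    qed
    also have "\<dots> = (norm (x - p))\<^sup>2 - i\<^sup>2 / inner y y"
      using ny by (simp add: t_def power2_eq_square field_simps)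
    finally show False using ny i by (simp add: divide_le_0_iff)
  qed
  then show ?thesis using p(1) by (auto simp: orthogonal_comp_def orthogonal_def)
qed

section \<open>Completeness of algebraic sums\<close>

lemma Cauchy_norm_bound:
  fixes s :: "nat \<Rightarrow> 'a::real_normed_vector" and t :: "nat \<Rightarrow> 'b::real_normed_vector"
  assumes s: "Cauchy s" and le: "\<And>j k. norm (t j - t k) \<le> K * norm (s j - s k)"
  shows "Cauchy t"
proof (rule metric_CauchyI)
  fix e :: real assume "e > 0"
  then have "e / (\<bar>K\<bar> + 1) > 0" by simp
  then obtain M where M: "\<And>j k. j \<ge> M \<Longrightarrow> k \<ge> M \<Longrightarrow> norm (s j - s k) < e / (\<bar>K\<bar> + 1)"
    using metric_CauchyD[OF s] by (metis dist_norm)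
  have "dist (t j) (t k) < e" if "j \<ge> M" "k \<ge> M" for j k
  proof -
    have "norm (t j - t k) \<le> (\<bar>K\<bar> + 1) * norm (s j - s k)"
      by (rule order_trans[OF le mult_right_mono]) auto
    also have "\<dots> < (\<bar>K\<bar> + 1) * (e / (\<bar>K\<bar> + 1))"
      using M[OF that] by (intro mult_strict_left_mono) auto
    finally show ?thesis by (simp add: dist_norm)
  qed
  then show "\<exists>M. \<forall>m\<ge>M. \<forall>n\<ge>M. dist (t m) (t n) < e" by blast
qed

text \<open>The lower bound makes the component in \<open>A\<close> depend Lipschitz continuously on
  the sum, so a Cauchy sequence in \<open>A + G\<close> splits into Cauchy sequences in
  \<open>A\<close> and in \<open>G\<close>.\<close>

lemma complete_csubspace_sum:
  assumes A: "complete_csubspace A" and G: "complete_csubspace G" and c: "c > 0"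
    and bd: "\<And>a g. a \<in> A \<Longrightarrow> g \<in> G \<Longrightarrow> c * norm a \<le> norm (a + g)"
  shows "complete_csubspace (A + G)"
proof -
  have sA: "complex_vector.subspace A" and sG: "complex_vector.subspace G"
    using A G by (simp_all add: complete_csubspace_def)
  have "\<exists>l\<in>A + G. s \<longlonglongrightarrow> l" if s: "\<And>k. s k \<in> A + G" "Cauchy s" for s
  proof -
    have "\<forall>k. \<exists>a g. a \<in> A \<and> g \<in> G \<and> s k = a + g"
      by (metis s(1) set_plus_elim)
    then obtain a g where ag: "\<And>k. a k \<in> A" "\<And>k. g k \<in> G" "\<And>k. s k = a k + g k"
      by metis
    have le: "norm (a j - a k) \<le> 1 / c * norm (s j - s k)" for j k
    proof -
      have "c * norm (a j - a k) \<le> norm ((a j - a k) + (g j - g k))"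
        using ag sA sG by (intro bd complex_vector.subspace_diff)
      also have "(a j - a k) + (g j - g k) = s j - s k" by (simp add: ag(3))
      finally show ?thesis using c by (simp add: field_simps)
    qed
    have "Cauchy a" using s(2) le by (rule Cauchy_norm_bound)
    moreover have "norm (g j - g k) \<le> (1 / c + 1) * norm (s j - s k)" for j k
    proof -
      have "g j - g k = (s j - s k) - (a j - a k)" by (simp add: ag(3))
      then have "norm (g j - g k) \<le> norm (s j - s k) + norm (a j - a k)"
        by (simp only: norm_triangle_ineq4)
      then show ?thesis using le[of j k] by (simp add: algebra_simps)
    qed
    with s(2) have "Cauchy g" by (rule Cauchy_norm_bound)
    ultimately obtain x y where "x \<in> A" "a \<longlonglongrightarrow> x" "y \<in> G" "g \<longlonglongrightarrow> y"
      using A G ag unfolding complete_csubspace_def complete_def by metis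
    then have "(\<lambda>k. a k + g k) \<longlonglongrightarrow> x + y" "x + y \<in> A + G"
      by (auto intro: tendsto_add)
    moreover have "s = (\<lambda>k. a k + g k)" using ag(3) by auto
    ultimately have "s \<longlonglongrightarrow> x + y" "x + y \<in> A + G" by simp_all
    then show ?thesis by blast
  qed
  moreover have "A + G = {x + y |x y. x \<in> A \<and> y \<in> G}"
    by (auto simp: set_plus_def)
  then have "complex_vector.subspace (A + G)"
    using complex_vector.subspace_sums[OF sA sG] by simp
  ultimately show ?thesis by (auto simp: complete_csubspace_def complete_def)
qed

section \<open>Splitting along the sign of a self-adjoint contraction\<close>

definition selfadjoint_contraction :: "('a::complex_inner \<Rightarrow> 'a) \<Rightarrow> bool"
  where "selfadjoint_contraction f \<longleftrightarrow>
    (\<forall>x y. inner (f x) y = inner x (f y)) \<and> (\<forall>c x. f (c *\<^sub>C x) = c *\<^sub>C f x) \<and>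
    (\<forall>x. norm (f x) \<le> norm x)"

context
  fixes f :: "'a::complex_inner \<Rightarrow> 'a"
  assumes f: "selfadjoint_contraction f"
begin

lemma sac_inner: "inner (f x) y = inner x (f y)"
  and sac_scaleC: "f (c *\<^sub>C x) = c *\<^sub>C f x"
  and sac_norm: "norm (f x) \<le> norm x"
  using f by (auto simp: selfadjoint_contraction_def)

lemma sac_scaleR: "f (r *\<^sub>R x) = r *\<^sub>R f x"
  using sac_scaleC[of "complex_of_real r" x] by (simp add: scaleC_of_real)

text \<open>Symmetry forces additivity: the defect is orthogonal to every vector, in particular to
  itself.\<close>

lemma sac_add: "f (x + y) = f x + f y"
proof -
  have "inner (f (x + y) - (f x + f y)) z = 0" for z
    by (simp add: inner_diff_left inner_add_left sac_inner)
  from this[of "f (x + y) - (f x + f y)"] show ?thesis by simp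
qed

lemma sac_bounded_linear: "bounded_linear f"
  by (rule bounded_linear_intro[of f 1]) (simp_all add: sac_add sac_scaleR sac_norm)

lemma sac_diff: "f (x - y) = f x - f y"
  by (rule linear_diff[OF bounded_linear.linear[OF sac_bounded_linear]])

lemma sac_zero: "f 0 = 0"
  by (rule linear_0[OF bounded_linear.linear[OF sac_bounded_linear]])

lemma sac_tendsto: "g \<longlonglongrightarrow> l \<Longrightarrow> (\<lambda>k. f (g k)) \<longlonglongrightarrow> f l"
  by (rule bounded_linear.tendsto[OF sac_bounded_linear])

end

section \<open>Products, averages and pointwise limits of self-adjoint contractions\<close>

lemma sac_compose:
  assumes "selfadjoint_contraction f" "selfadjoint_contraction g" "\<And>x. f (g x) = g (f x)"
  shows "selfadjoint_contraction (\<lambda>x. f (g x))"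
  unfolding selfadjoint_contraction_def
proof (intro conjI allI)
  show "inner (f (g x)) y = inner x (f (g y))" for x y
    by (metis assms sac_inner)
  show "f (g (c *\<^sub>C x)) = c *\<^sub>C f (g x)" for c x
    by (simp add: sac_scaleC assms)
  show "norm (f (g x)) \<le> norm x" for x
    using sac_norm[OF assms(1)] sac_norm[OF assms(2)] order_trans by blast
qed

lemma sac_average:
  assumes "selfadjoint_contraction f" "selfadjoint_contraction g"
  shows "selfadjoint_contraction (\<lambda>x. (1/2) *\<^sub>R (f x + g x))"
  unfolding selfadjoint_contraction_def
proof (intro conjI allI)
  show "inner ((1/2) *\<^sub>R (f x + g x)) y = inner x ((1/2) *\<^sub>R (f y + g y))" for x y
    by (simp add: inner_add_left inner_add_right sac_inner[OF assms(1)] sac_inner[OF assms(2)])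
  show "(1/2) *\<^sub>R (f (c *\<^sub>C x) + g (c *\<^sub>C x)) = c *\<^sub>C (1/2) *\<^sub>R (f x + g x)" for c x
    by (simp add: sac_scaleC assms scaleC_scaleC scaleC_add_right mult.commute flip: scaleC_of_real)
  show "norm ((1/2) *\<^sub>R (f x + g x)) \<le> norm x" for x
    using norm_triangle_ineq[of "f x" "g x"] sac_norm[OF assms(1), of x] sac_norm[OF assms(2), of x]
    by simp
qed

lemma sac_limit:
  assumes f: "\<And>k. selfadjoint_contraction (f k)" and lim: "\<And>x. (\<lambda>k. f k x) \<longlonglongrightarrow> g x"
  shows "selfadjoint_contraction g"
  unfolding selfadjoint_contraction_def
proof (intro conjI allI)
  fix x y c
  have "(\<lambda>k. inner (f k x) y) \<longlonglongrightarrow> inner (g x) y"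
    by (intro tendsto_intros lim)
  moreover have "(\<lambda>k. inner (f k x) y) \<longlonglongrightarrow> inner x (g y)"
    unfolding sac_inner[OF f] by (intro tendsto_intros lim)
  ultimately show "inner (g x) y = inner x (g y)" by (rule LIMSEQ_unique)
  have "(\<lambda>k. f k (c *\<^sub>C x)) \<longlonglongrightarrow> c *\<^sub>C g x"
    unfolding sac_scaleC[OF f] by (intro bounded_linear.tendsto[OF bounded_linear_scaleC] lim)
  then show "g (c *\<^sub>C x) = c *\<^sub>C g x" by (rule LIMSEQ_unique[OF lim])
  show "norm (g x) \<le> norm x"
    by (rule LIMSEQ_le_const2[OF tendsto_norm[OF lim]]) (auto simp: sac_norm[OF f])
qed

text \<open>
  The iterates converge to \<open>Y\<close> with \<open>2 Y = C + Y\<^sup>2\<close>, that is, \<open>(1 - Y)\<^sup>2 = 1 - C\<close>. The scalar iteration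
  for \<open>C = 1\<close> majorizes the operator iteration, which gives convergence without a spectral theorem.
\<close>

primrec sqrt_iter :: "('a::real_vector \<Rightarrow> 'a) \<Rightarrow> nat \<Rightarrow> 'a \<Rightarrow> 'a" where
  "sqrt_iter C 0 = (\<lambda>x. 0)"
| "sqrt_iter C (Suc k) = (\<lambda>x. (1/2) *\<^sub>R (C x + sqrt_iter C k (sqrt_iter C k x)))"

primrec scalar_iter :: "nat \<Rightarrow> real" where
  "scalar_iter 0 = 0"
| "scalar_iter (Suc k) = (1 + (scalar_iter k)\<^sup>2) / 2"

lemma scalar_iter_bounds: "0 \<le> scalar_iter k \<and> scalar_iter k \<le> 1"
proof (induction k)
  case (Suc k)
  then have "(scalar_iter k)\<^sup>2 \<le> 1" by (simp add: power_le_one)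
  then show ?case by simp
qed simp

lemma scalar_iter_le_Suc: "scalar_iter k \<le> scalar_iter (Suc k)"
proof -
  \<comment> \<open>The increment of the scalar iteration is exactly half of this square.\<close>
  have "0 \<le> (1 - scalar_iter k)\<^sup>2" by simp
  then show ?thesis by (simp add: power2_eq_square algebra_simps)
qed

lemma Cauchy_scalar_iter: "Cauchy scalar_iter"
proof -
  have "incseq scalar_iter" by (simp only: incseq_SucI scalar_iter_le_Suc)
  moreover have "\<forall>k. scalar_iter k \<le> 1" using scalar_iter_bounds by blast
  ultimately show ?thesis
    by (metis incseq_convergent LIMSEQ_imp_Cauchy)
qed

context
  fixes C :: "'a::complex_inner \<Rightarrow> 'a"
  assumes C: "selfadjoint_contraction C"
begin

text \<open>Each iterate is a polynomial in \<open>C\<close>, so whatever commutes with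
  \<open>C\<close> commutes with it.\<close>

lemma sqrt_iter_commute:
  assumes "selfadjoint_contraction g" "\<And>x. g (C x) = C (g x)"
  shows "g (sqrt_iter C k x) = sqrt_iter C k (g x)"
  by (induction k arbitrary: x) (simp_all add: assms sac_zero[OF assms(1)] sac_scaleR[OF assms(1)] sac_add[OF assms(1)])

lemma sac_sqrt_iter: "selfadjoint_contraction (sqrt_iter C k)"
proof (induction k)
  case 0
  show ?case by (simp add: selfadjoint_contraction_def complex_vector.scale_zero_right)
next
  case (Suc k)
  show ?case using sac_average[OF C sac_compose[OF Suc Suc]] by simp
qed

lemma sqrt_iter_commutes: "sqrt_iter C j (sqrt_iter C k x) = sqrt_iter C k (sqrt_iter C j x)"
  by (rule sqrt_iter_commute[OF sac_sqrt_iter]) (simp add: sqrt_iter_commute[OF C])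

lemma norm_sqrt_iter: "norm (sqrt_iter C k x) \<le> scalar_iter k * norm x"
proof (induction k arbitrary: x)
  case (Suc k)
  have "norm (sqrt_iter C k (sqrt_iter C k x)) \<le> scalar_iter k * (scalar_iter k * norm x)"
    using scalar_iter_bounds[of k] by (intro order_trans[OF Suc] mult_left_mono Suc) auto
  then have "norm (C x + sqrt_iter C k (sqrt_iter C k x)) \<le> (1 + (scalar_iter k)\<^sup>2) * norm x"
    using norm_triangle_ineq[of "C x" "sqrt_iter C k (sqrt_iter C k x)"] sac_norm[OF C, of x]
    by (simp add: power2_eq_square distrib_right)
  then show ?case by simp
qed simp

text \<open>Since iterates commute, a difference of their squares factors as sum times difference.
  The scalar iteration obeys the same identity, with all factors nonnegative, so the bound
  propagates by induction.\<close>

lemma norm_sqrt_iter_diff_Suc: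
  "norm (sqrt_iter C (Suc k) x - sqrt_iter C k x) \<le> (scalar_iter (Suc k) - scalar_iter k) * norm x"
proof (induction k arbitrary: x)
  case 0
  show ?case using sac_norm[OF C, of x] by simp
next
  case (Suc k)
  let ?Y = "sqrt_iter C" and ?y = scalar_iter
  define d where "d = ?Y (Suc k) x - ?Y k x"
  have nonneg: "0 \<le> ?y k" "0 \<le> ?y (Suc k)" using scalar_iter_bounds by blast+
  have step: "?Y (Suc k) x = (1/2) *\<^sub>R (C x + ?Y k (?Y k x))" for k x by simp
  have "?Y (Suc (Suc k)) x - ?Y (Suc k) x = (1/2) *\<^sub>R (?Y (Suc k) (?Y (Suc k) x) - ?Y k (?Y k x))"
    unfolding step[of "Suc k"] step[of k x] by (simp only: scaleR_diff_right scaleR_add_right) simp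
  also have "?Y (Suc k) (?Y (Suc k) x) - ?Y k (?Y k x) = ?Y (Suc k) d + ?Y k d"
    unfolding d_def by (simp only: sac_diff[OF sac_sqrt_iter] sqrt_iter_commutes[of "Suc k" k]) simp
  finally have "norm (?Y (Suc (Suc k)) x - ?Y (Suc k) x) \<le> (norm (?Y (Suc k) d) + norm (?Y k d)) / 2"
    using norm_triangle_ineq[of "?Y (Suc k) d" "?Y k d"] by (simp del: sqrt_iter.simps)
  also have "\<dots> \<le> (?y (Suc k) + ?y k) / 2 * norm d"
    using norm_sqrt_iter[of "Suc k" d] norm_sqrt_iter[of k d]
    by (simp del: sqrt_iter.simps scalar_iter.simps add: algebra_simps add_divide_distrib)
  also have "\<dots> \<le> (?y (Suc k) + ?y k) / 2 * ((?y (Suc k) - ?y k) * norm x)"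
    using nonneg unfolding d_def by (intro mult_left_mono Suc) auto
  also have "(?y (Suc k) + ?y k) / 2 * ((?y (Suc k) - ?y k) * norm x)
      = ((?y (Suc k))\<^sup>2 - (?y k)\<^sup>2) / 2 * norm x"
    by (simp only: power2_eq_square) (simp del: scalar_iter.simps add: field_simps)
  also have "((?y (Suc k))\<^sup>2 - (?y k)\<^sup>2) / 2 = ?y (Suc (Suc k)) - ?y (Suc k)"
    unfolding scalar_iter.simps(2)[of "Suc k"] scalar_iter.simps(2)[of k] by (simp add: field_simps)
  finally show ?case .
qed

text \<open>Telescoping the one-step bounds shows that the operator iteration is Cauchy wherever the
  scalar one is.\<close>

lemma norm_sqrt_iter_diff:
  "norm (sqrt_iter C j x - sqrt_iter C k x) \<le> norm x * norm (scalar_iter j - scalar_iter k)"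
proof -
  have le: "norm (sqrt_iter C j x - sqrt_iter C k x) \<le> (scalar_iter j - scalar_iter k) * norm x"
    if "k \<le> j" for j k
    using that
  proof (induction j rule: dec_induct)
    case (step j)
    have "sqrt_iter C (Suc j) x - sqrt_iter C k x
        = (sqrt_iter C (Suc j) x - sqrt_iter C j x) + (sqrt_iter C j x - sqrt_iter C k x)"
      by simp
    then have "norm (sqrt_iter C (Suc j) x - sqrt_iter C k x)
        \<le> norm (sqrt_iter C (Suc j) x - sqrt_iter C j x) + norm (sqrt_iter C j x - sqrt_iter C k x)"
      by (simp only: norm_triangle_ineq)
    with step.IH norm_sqrt_iter_diff_Suc[of j x] show ?case
      unfolding left_diff_distrib by linarith
  qed simp
  have "(scalar_iter j - scalar_iter k) * norm x \<le> norm x * \<bar>scalar_iter j - scalar_iter k\<bar>" for j k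
    by (simp add: mult.commute mult_left_mono)
  with le[of k j] le[of j k] show ?thesis
    by (metis abs_minus_commute nle_le norm_minus_commute order_trans real_norm_def)
qed

text \<open>All iterates take values in \<open>N\<close>, whose completeness supplies the pointwise
  limits. The fixed-point equation and the commutation property then pass to the limit.\<close>

lemma sqrt_iter_limit:
  assumes N: "complete_csubspace N" and CN: "\<And>x. C x \<in> N"
  shows "\<exists>Y. selfadjoint_contraction Y \<and> (\<forall>x. Y x \<in> N \<and> 2 *\<^sub>R Y x = C x + Y (Y x)) \<and>
    (\<forall>g. selfadjoint_contraction g \<longrightarrow> (\<forall>x. g (C x) = C (g x)) \<longrightarrow> (\<forall>x. g (Y x) = Y (g x)))"
proof -
  have sub: "subspace N" using N by (simp add: complete_csubspace_def csubspace_imp_subspace)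
  have "sqrt_iter C k x \<in> N" for k x
    using sub by (induction k arbitrary: x) (simp_all only: sqrt_iter.simps subspace_0 subspace_scale subspace_add CN)
  moreover have "Cauchy (\<lambda>k. sqrt_iter C k x)" for x
    using Cauchy_scalar_iter norm_sqrt_iter_diff by (rule Cauchy_norm_bound)
  moreover have "complete N" using N by (simp add: complete_csubspace_def)
  ultimately have "\<exists>l. l \<in> N \<and> (\<lambda>k. sqrt_iter C k x) \<longlonglongrightarrow> l" for x
    by (metis completeE)
  then obtain Y where Y: "\<And>x. Y x \<in> N" "\<And>x. (\<lambda>k. sqrt_iter C k x) \<longlonglongrightarrow> Y x"
    by metis
  have sac: "selfadjoint_contraction Y"
    using sac_sqrt_iter Y(2) by (rule sac_limit)
  have "2 *\<^sub>R Y x = C x + Y (Y x)" for x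
  proof -
    \<comment> \<open>Both the operator and its argument vary with \<open>k\<close>. As all iterates
      are contractions, replacing the inner iterate by its limit costs at most
      \<open>norm (sqrt_iter C k x - Y x)\<close>.\<close>
    have "(\<lambda>k. sqrt_iter C k (sqrt_iter C k x) - sqrt_iter C k (Y x)) \<longlonglongrightarrow> 0"
    proof (rule Lim_null_comparison)
      show "\<forall>\<^sub>F k in sequentially. norm (sqrt_iter C k (sqrt_iter C k x) - sqrt_iter C k (Y x))
          \<le> norm (sqrt_iter C k x - Y x)"
        by (simp add: sac_norm[OF sac_sqrt_iter] flip: sac_diff[OF sac_sqrt_iter])
      show "(\<lambda>k. norm (sqrt_iter C k x - Y x)) \<longlonglongrightarrow> 0"
        using Y(2)[of x] by (simp add: LIM_zero tendsto_norm_zero)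
    qed
    from tendsto_add[OF this Y(2)[of "Y x"]]
    have "(\<lambda>k. sqrt_iter C k (sqrt_iter C k x)) \<longlonglongrightarrow> Y (Y x)" by simp
    then have "(\<lambda>k. C x + sqrt_iter C k (sqrt_iter C k x)) \<longlonglongrightarrow> C x + Y (Y x)"
      by (intro tendsto_intros)
    moreover have "(\<lambda>k. 2 *\<^sub>R sqrt_iter C (Suc k) x) \<longlonglongrightarrow> 2 *\<^sub>R Y x"
      by (intro tendsto_intros LIMSEQ_Suc Y(2))
    ultimately show ?thesis by (simp add: LIMSEQ_unique)
  qed
  moreover have "g (Y x) = Y (g x)"
    if "selfadjoint_contraction g" "\<forall>x. g (C x) = C (g x)" for g x
    using sac_tendsto[OF that(1) Y(2)[of x]] Y(2)[of "g x"] that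
    by (simp add: sqrt_iter_commute LIMSEQ_unique)
  ultimately show ?thesis using sac Y(1) by blast
qed

end

text \<open>On \<open>N\<close>, the absolute value of \<open>T\<close> is a positive square root
  \<open>W\<close> of the square of \<open>T\<close>. Let \<open>A\<close> be the kernel of
  \<open>W - T\<close> in \<open>N\<close> and \<open>B\<close> its orthogonal complement there.
  Then \<open>T\<close> equals \<open>W\<close> on \<open>A\<close> and \<open>- W\<close> on
  \<open>B\<close>. The projection \<open>P\<close> lets operators on \<open>N\<close> be handled as
  operators on the whole space.\<close>

lemma sign_decomposition:
  fixes T :: "'a::complex_inner \<Rightarrow> 'a"
  assumes N: "complete_csubspace N"
    and P: "selfadjoint_contraction P" "\<And>x. P x \<in> N" "\<And>x. x \<in> N \<Longrightarrow> P x = x"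
    and T: "selfadjoint_contraction T" "\<And>x. T x \<in> N" "\<And>x. T (P x) = T x"
  shows "\<exists>A B. complete_csubspace A \<and> complete_csubspace B \<and> N = A + B \<and>
    (\<forall>a\<in>A. \<forall>b\<in>B. inner a b = 0 \<and> inner (T a) b = 0) \<and>
    (\<forall>a\<in>A. inner (T a) a \<ge> 0) \<and> (\<forall>b\<in>B. inner (T b) b \<le> 0)"
proof -
  have cN: "complex_vector.subspace N" using N by (simp add: complete_csubspace_def)
  then have sub: "subspace N" by (rule csubspace_imp_subspace)
  define C where "C = (\<lambda>x. P x - T (T x))"
  have CN: "C x \<in> N" for x
    by (simp add: C_def P T sub subspace_diff)
  have C: "selfadjoint_contraction C"
    unfolding selfadjoint_contraction_def
  proof (intro conjI allI)
    show "inner (C x) y = inner x (C y)" for x y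
      by (simp add: C_def inner_diff_left inner_diff_right sac_inner[OF P(1)] sac_inner[OF T(1)])
    show "C (c *\<^sub>C x) = c *\<^sub>C C x" for c x
      by (simp add: C_def sac_scaleC[OF P(1)] sac_scaleC[OF T(1)] complex_vector.scale_right_diff_distrib)
    \<comment> \<open>Expanding the square produces the cross term
      \<open>- 2 * (norm (T x))\<^sup>2\<close>, which outweighs
      \<open>(norm (T (T x)))\<^sup>2\<close> because \<open>T\<close> is a contraction.\<close>
    show "norm (C x) \<le> norm x" for x
    proof -
      have "inner (P x) (T (T x)) = (norm (T x))\<^sup>2"
        by (simp only: power2_norm_eq_inner T(3) flip: sac_inner[OF T(1)])
      then have "(norm (C x))\<^sup>2 = (norm (P x))\<^sup>2 - 2 * (norm (T x))\<^sup>2 + (norm (T (T x)))\<^sup>2"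
        unfolding C_def power2_norm_eq_inner
        by (simp add: inner_diff_left inner_diff_right inner_commute[of "T (T x)" "P x"])
      also have "\<dots> \<le> (norm (P x))\<^sup>2 - (norm (T x))\<^sup>2"
        using power_mono[OF sac_norm[OF T(1), of "T x"], of 2] by simp
      also have "\<dots> \<le> (norm x)\<^sup>2"
        using power_mono[OF sac_norm[OF P(1), of x] norm_ge_zero, of 2] zero_le_power2[of "norm (T x)"] by linarith
      finally show ?thesis by (rule power2_le_imp_le) simp
    qed
  qed
  obtain Y where Y: "selfadjoint_contraction Y" "\<And>x. Y x \<in> N" "\<And>x. 2 *\<^sub>R Y x = C x + Y (Y x)"
    and comm: "\<And>g x. selfadjoint_contraction g \<Longrightarrow> (\<And>x. g (C x) = C (g x)) \<Longrightarrow> g (Y x) = Y (g x)"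
    using sqrt_iter_limit[OF C N CN] by metis
  have TY: "T (Y x) = Y (T x)" for x
    by (rule comm[OF T(1)]) (simp add: C_def sac_diff[OF T(1)] T(2,3) P(3))
  \<comment> \<open>On \<open>N\<close>, where \<open>P\<close> is the identity, the equation for
    \<open>Y\<close> says that \<open>1 - Y\<close> squares to \<open>1 - C\<close>, that is, to the
    square of \<open>T\<close>. It is positive there since \<open>Y\<close> is a
    contraction.\<close>
  define W where "W = (\<lambda>x. P x - Y x)"
  have WN: "W x \<in> N" for x by (simp add: W_def P Y sub subspace_diff)
  have Wlin: "W (x + y) = W x + W y" "W (x - y) = W x - W y" "W (c *\<^sub>C x) = c *\<^sub>C W x" for x y c
    by (simp_all add: W_def sac_add[OF P(1)] sac_add[OF Y(1)] sac_diff[OF P(1)] sac_diff[OF Y(1)]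
        sac_scaleC[OF P(1)] sac_scaleC[OF Y(1)] complex_vector.scale_right_diff_distrib)
  have W0: "W 0 = 0" by (simp add: W_def sac_zero[OF P(1)] sac_zero[OF Y(1)])
  have Winner: "inner (W x) y = inner x (W y)" for x y
    by (simp add: W_def inner_diff_left inner_diff_right sac_inner[OF P(1)] sac_inner[OF Y(1)])
  have WW: "W (W x) = T (T x)" if "x \<in> N" for x
  proof -
    have "W (W x) = x - 2 *\<^sub>R Y x + Y (Y x)"
      using that by (simp add: W_def P(3) Y(2) sac_diff[OF P(1)] sac_diff[OF Y(1)] scaleR_2)
    then show ?thesis using that by (simp add: Y(3) C_def P(3))
  qed
  have TW: "T (W x) = W (T x)" if "x \<in> N" for x
    using that by (simp add: W_def sac_diff[OF T(1)] TY P(3) T(2))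
  have Wpos: "inner (W x) x \<ge> 0" if "x \<in> N" for x
  proof -
    have "inner (Y x) x \<le> norm (Y x) * norm x" by (rule norm_cauchy_schwarz)
    also have "\<dots> \<le> norm x * norm x" by (intro mult_right_mono sac_norm[OF Y(1)]) simp
    finally show ?thesis
      using that by (simp add: W_def P(3) inner_diff_left power2_eq_square flip: power2_norm_eq_inner)
  qed
  define A where "A = N \<inter> {x. W x = T x}"
  define B where "B = N \<inter> orthogonal_comp A"
  have "complex_vector.subspace {x. W x = T x}"
    unfolding complex_vector.subspace_def
    by (auto simp: Wlin W0 sac_add[OF T(1)] sac_scaleC[OF T(1)] sac_zero[OF T(1)])
  moreover have "closed {x. W x = T x}"
    unfolding W_def
    by (intro closed_Collect_eq continuous_intros bounded_linear.continuous_on[OF sac_bounded_linear[OF P(1)]]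
        bounded_linear.continuous_on[OF sac_bounded_linear[OF T(1)]]
        bounded_linear.continuous_on[OF sac_bounded_linear[OF Y(1)]])
  ultimately have A: "complete_csubspace A"
    unfolding A_def using N by (simp add: complete_csubspace_Int)
  then have B: "complete_csubspace B"
    unfolding B_def by (intro complete_csubspace_orthogonal_comp_Int N) (simp add: complete_csubspace_def)
  have TA: "T a \<in> A" if "a \<in> A" for a
  proof -
    have "a \<in> N" "W a = T a" using that by (simp_all add: A_def)
    then have "W (T a) = T (T a)" using TW by metis
    then show ?thesis by (simp add: A_def T(2))
  qed
  have orth: "inner a b = 0" if "a \<in> A" "b \<in> B" for a b
    using that by (auto simp: B_def orthogonal_comp_def orthogonal_def)
  have WB: "W b = - T b" if b: "b \<in> B" for b
  proof -
    \<comment> \<open>As \<open>W\<close> and \<open>T\<close> commute and have equal squares on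
      \<open>N\<close>, \<open>W - T\<close> annihilates \<open>u\<close>, so \<open>u\<close> lies
      in \<open>A\<close>. Moving \<open>W + T\<close> across the inner product gives
      \<open>inner u u = 2 * inner (T u) b\<close>, which vanishes because \<open>T u\<close> stays
      in \<open>A\<close>.\<close>
    define u where "u = W b + T b"
    have bN: "b \<in> N" using b by (simp add: B_def)
    have "W u = T u"
      by (simp add: u_def Wlin sac_add[OF T(1)] WW[OF bN] TW[OF bN])
    then have uA: "u \<in> A" using sub by (simp add: A_def u_def WN T(2) subspace_add)
    have "inner u u = inner (W u + T u) b"
      by (simp add: u_def inner_add_left inner_add_right Winner sac_inner[OF T(1)])
    also have "\<dots> = 2 * inner (T u) b"
      using uA by (simp add: A_def inner_add_left)
    also have "\<dots> = 0" using orth[OF TA[OF uA] b] by simp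
    finally show ?thesis by (simp add: u_def eq_neg_iff_add_eq_0)
  qed
  have "N = A + B"
  proof
    show "A + B \<subseteq> N"
      by (auto simp: set_plus_def A_def B_def intro: subspace_add[OF sub])
    show "N \<subseteq> A + B"
    proof
      fix x assume x: "x \<in> N"
      obtain a where a: "a \<in> A" "x - a \<in> orthogonal_comp A"
        using orthogonal_decomposition[of A x] A csubspace_imp_subspace[of A]
        unfolding complete_csubspace_def by blast
      have "a \<in> N" using a(1) by (simp add: A_def)
      then have "x - a \<in> B" using a(2) x subspace_diff[OF sub] by (simp add: B_def)
      from set_plus_intro[OF a(1) this] show "x \<in> A + B" by simp
    qed
  qed
  moreover have "\<forall>a\<in>A. \<forall>b\<in>B. inner a b = 0 \<and> inner (T a) b = 0"
    using orth TA by blast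
  moreover have "\<forall>a\<in>A. inner (T a) a \<ge> 0"
  proof
    fix a assume "a \<in> A"
    then have "W a = T a" "a \<in> N" by (simp_all add: A_def)
    then show "inner (T a) a \<ge> 0" using Wpos[of a] by simp
  qed
  moreover have "\<forall>b\<in>B. inner (T b) b \<le> 0"
  proof
    fix b assume b: "b \<in> B"
    then have "inner (W b) b \<ge> 0" using Wpos by (simp add: B_def)
    then show "inner (T b) b \<le> 0" by (simp add: WB[OF b])
  qed
  ultimately show ?thesis
    using A B by (intro exI[of _ A] exI[of _ B] conjI)
qed

section \<open>Complements compatible with an orthogonal decomposition\<close>

lemma orthogonal_projection:
  fixes S :: "'a::complex_inner set"
  assumes S: "complete_csubspace S"
  obtains P where "selfadjoint_contraction P" "\<And>x. P x \<in> S" "\<And>x. x - P x \<in> orthogonal_comp S"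
    "\<And>x. x \<in> S \<Longrightarrow> P x = x" "\<And>x. x \<in> orthogonal_comp S \<Longrightarrow> P x = 0"
proof -
  have cS: "complex_vector.subspace S" using S by (simp add: complete_csubspace_def)
  then have sub: "subspace S" by (rule csubspace_imp_subspace)
  have "\<exists>p\<in>S. x - p \<in> orthogonal_comp S" for x
    using orthogonal_decomposition[of S x] S sub by (simp add: complete_csubspace_def)
  then obtain P where P: "\<And>x. P x \<in> S" "\<And>x. x - P x \<in> orthogonal_comp S"
    by metis
  \<comment> \<open>The difference of two candidates lies both in \<open>S\<close> and in its
    orthogonal complement. This uniqueness yields homogeneity and the values on both
    subspaces.\<close>
  have unique: "P x = p" if "p \<in> S" "x - p \<in> orthogonal_comp S" for x p
  proof -
    have "(x - p) - (x - P x) \<in> orthogonal_comp S"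
      using that(2) P(2) by (rule subspace_diff[OF subspace_orthogonal_comp])
    moreover have "P x - p \<in> S" using P(1) that(1) by (rule subspace_diff[OF sub])
    ultimately have "inner (P x - p) (P x - p) = 0"
      by (auto simp: orthogonal_comp_def orthogonal_def)
    then show ?thesis by simp
  qed
  have orth: "inner y (x - P x) = 0" "inner (x - P x) y = 0" if "y \<in> S" for x y
    using P(2)[of x] that by (auto simp: orthogonal_comp_def orthogonal_def inner_commute)
  have "selfadjoint_contraction P"
    unfolding selfadjoint_contraction_def
  proof (intro conjI allI)
    fix x y c
    show "inner (P x) y = inner x (P y)"
      using orth(1)[OF P(1)[of x], of y] orth(2)[OF P(1)[of y], of x]
      by (simp add: inner_diff_left inner_diff_right)
    have "c *\<^sub>C (x - P x) \<in> orthogonal_comp S"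
      using csubspace_orthogonal_comp[OF cS] P(2) by (rule complex_vector.subspace_scale)
    then show "P (c *\<^sub>C x) = c *\<^sub>C P x"
      by (intro unique complex_vector.subspace_scale[OF cS] P(1))
        (simp add: complex_vector.scale_right_diff_distrib)
    have "(norm x)\<^sup>2 = (norm (P x))\<^sup>2 + (norm (x - P x))\<^sup>2"
      using norm_add_Pythagorean[of "P x" "x - P x"] orth(1)[OF P(1)[of x], of x]
      by (simp add: orthogonal_def)
    then have "(norm (P x))\<^sup>2 \<le> (norm x)\<^sup>2" by simp
    then show "norm (P x) \<le> norm x" by (rule power2_le_imp_le) simp
  qed
  moreover have "P x = x" if "x \<in> S" for x
    using that by (rule unique) (simp add: subspace_0[OF subspace_orthogonal_comp])
  moreover have "P x = 0" if "x \<in> orthogonal_comp S" for x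
    using subspace_0[OF sub] by (rule unique) (simp add: that)
  ultimately show ?thesis by (rule that[OF _ P])
qed

text \<open>Besides the complement property, completeness of \<open>N + M1\<close> is recorded: the
  induction over several summands needs it to intersect this sum with the second summand.\<close>

lemma two_summand_complement:
  fixes N :: "'a::complex_inner set"
  assumes E1: "complete_csubspace E1" and E2: "complete_csubspace E2"
    and orth: "\<And>x y. x \<in> E1 \<Longrightarrow> y \<in> E2 \<Longrightarrow> inner x y = 0"
    and N: "complete_csubspace N" "N \<subseteq> E1 + E2"
  shows "\<exists>M1 M2. complete_csubspace M1 \<and> M1 \<subseteq> E1 \<and> complete_csubspace M2 \<and> M2 \<subseteq> E2 \<and>
    complete_csubspace (N + M1) \<and> E1 + E2 \<subseteq> (N + M1) + M2 \<and>
    (\<forall>v\<in>N. \<forall>m1\<in>M1. \<forall>m2\<in>M2. v + m1 + m2 = 0 \<longrightarrow> m1 = 0 \<and> m2 = 0)"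
proof -
  obtain P where P: "selfadjoint_contraction P" "\<And>x. P x \<in> N" "\<And>x. x \<in> N \<Longrightarrow> P x = x"
    using orthogonal_projection[OF N(1)] by metis
  obtain Q1 where Q1: "selfadjoint_contraction Q1" "\<And>x. Q1 x \<in> E1" "\<And>x. x \<in> E1 \<Longrightarrow> Q1 x = x"
      "\<And>x. x \<in> orthogonal_comp E1 \<Longrightarrow> Q1 x = 0"
    using orthogonal_projection[OF E1] by metis
  obtain Q2 where Q2: "selfadjoint_contraction Q2" "\<And>x. Q2 x \<in> E2" "\<And>x. x \<in> E2 \<Longrightarrow> Q2 x = x"
      "\<And>x. x \<in> orthogonal_comp E2 \<Longrightarrow> Q2 x = 0"
    using orthogonal_projection[OF E2] by metis
  have cE: "complex_vector.subspace E1" "complex_vector.subspace E2"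
    using E1 E2 by (simp_all add: complete_csubspace_def)
  note sE = csubspace_imp_subspace[OF cE(1)] csubspace_imp_subspace[OF cE(2)]
  have Q12: "Q2 x = 0" if "x \<in> E1" for x
    using orth[OF that] by (intro Q2(4)) (auto simp: orthogonal_comp_def orthogonal_def inner_commute[of _ x])
  have Q21: "Q1 y = 0" if "y \<in> E2" for y
    using that orth by (intro Q1(4)) (auto simp: orthogonal_comp_def orthogonal_def)
  note add1 = sac_add[OF Q1(1)] and add2 = sac_add[OF Q2(1)]
  have orth': "inner (Q2 x) (Q1 y) = 0" "inner (Q1 x) (Q2 y) = 0" for x y
    using orth[OF Q1(2) Q2(2)] by (simp_all add: inner_commute[of "Q2 x"])
  have decomp: "x = Q1 x + Q2 x" if x: "x \<in> N" for x
  proof -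
    obtain y z where "x = y + z" "y \<in> E1" "z \<in> E2"
      using x N(2) by (meson set_plus_elim subsetD)
    then show ?thesis by (simp add: add1 add2 Q1(3) Q2(3) Q12 Q21)
  qed
  have inner_decomp: "inner x y = inner (Q1 x) (Q1 y) + inner (Q2 x) (Q2 y)" if "x \<in> N" "y \<in> N" for x y
  proof -
    have "inner x y = inner (Q1 x + Q2 x) (Q1 y + Q2 y)" using decomp that by metis
    then show ?thesis by (simp add: inner_add_left inner_add_right orth')
  qed

  \<comment> \<open>The compression of \<open>Q1 - Q2\<close> to \<open>N\<close>, precomposed with
    \<open>P\<close> so that it is defined everywhere.\<close>
  define T where "T = (\<lambda>x. P (Q1 (P x) - Q2 (P x)))"
  have inner_T: "inner (T x) y = inner (Q1 x) (Q1 y) - inner (Q2 x) (Q2 y)" if "x \<in> N" "y \<in> N" for x y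
  proof -
    have "inner (T x) y = inner (Q1 x - Q2 x) y"
      using that by (simp add: T_def sac_inner[OF P(1)] P(3))
    also have "inner (Q1 x - Q2 x) y = inner (Q1 x - Q2 x) (Q1 y + Q2 y)"
      using decomp[OF that(2)] by simp
    finally show ?thesis by (simp add: inner_diff_left inner_add_right orth')
  qed
  have T: "selfadjoint_contraction T"
    unfolding selfadjoint_contraction_def
  proof (intro conjI allI)
    show "inner (T x) y = inner x (T y)" for x y
      by (simp add: T_def sac_inner[OF P(1)] sac_inner[OF Q1(1)] sac_inner[OF Q2(1)]
          inner_diff_left inner_diff_right sac_diff[OF P(1)])
    show "T (c *\<^sub>C x) = c *\<^sub>C T x" for c x
      by (simp add: T_def sac_scaleC[OF P(1)] sac_scaleC[OF Q1(1)] sac_scaleC[OF Q2(1)]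
          flip: complex_vector.scale_right_diff_distrib)
    show "norm (T x) \<le> norm x" for x
    proof -
      have "norm (T x) \<le> norm (Q1 (P x) - Q2 (P x))" unfolding T_def by (rule sac_norm[OF P(1)])
      \<comment> \<open>On \<open>N\<close> the vectors \<open>Q1 y + Q2 y\<close> and
        \<open>Q1 y - Q2 y\<close> have equal norm, as the two ranges are orthogonal.\<close>
      also have "\<dots> = norm (P x)"
      proof -
        have "inner (Q1 (P x) - Q2 (P x)) (Q1 (P x) - Q2 (P x)) = inner (P x) (P x)"
          using inner_decomp[OF P(2) P(2), of x x] by (simp add: inner_diff_left inner_diff_right orth')
        then show ?thesis by (simp add: norm_eq_sqrt_inner)
      qed
      also have "\<dots> \<le> norm x" by (rule sac_norm[OF P(1)])
      finally show ?thesis .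
    qed
  qed
  have "\<exists>A B. complete_csubspace A \<and> complete_csubspace B \<and> N = A + B \<and>
    (\<forall>a\<in>A. \<forall>b\<in>B. inner a b = 0 \<and> inner (T a) b = 0) \<and>
    (\<forall>a\<in>A. inner (T a) a \<ge> 0) \<and> (\<forall>b\<in>B. inner (T b) b \<le> 0)"
    using N(1) P T by (rule sign_decomposition) (simp_all add: T_def P(2) P(3)[OF P(2)])
  then obtain A B where A: "complete_csubspace A" and B: "complete_csubspace B" and NAB: "N = A + B"
    and AB: "\<And>a b. a \<in> A \<Longrightarrow> b \<in> B \<Longrightarrow> inner a b = 0"
    and TAB: "\<And>a b. a \<in> A \<Longrightarrow> b \<in> B \<Longrightarrow> inner (T a) b = 0"
    and TA: "\<And>a. a \<in> A \<Longrightarrow> inner (T a) a \<ge> 0"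
    and TB: "\<And>b. b \<in> B \<Longrightarrow> inner (T b) b \<le> 0"
    by metis
  have cA: "complex_vector.subspace A" and cB: "complex_vector.subspace B"
    using A B by (simp_all add: complete_csubspace_def)
  note sA = csubspace_imp_subspace[OF cA] and sB = csubspace_imp_subspace[OF cB]
  have AN: "a \<in> N" if "a \<in> A" for a
    unfolding NAB using set_plus_intro[OF that subspace_0[OF sB]] by simp
  have BN: "b \<in> N" if "b \<in> B" for b
    unfolding NAB using set_plus_intro[OF subspace_0[OF sA] that] by simp
  \<comment> \<open>The inner products of the \<open>Q1\<close> parts and of the \<open>Q2\<close>
    parts have sum \<open>inner a b\<close> and difference \<open>inner (T a) b\<close>; both are 0,
    so each inner product is 0.\<close>
  have Q1AB: "inner (Q1 a) (Q1 b) = 0" and Q2AB: "inner (Q2 b) (Q2 a) = 0"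
    if "a \<in> A" "b \<in> B" for a b
    using AB[OF that] TAB[OF that] inner_decomp[OF AN BN, OF that] inner_T[OF AN BN, OF that]
    by (simp_all add: inner_commute[of "Q2 b"])
  \<comment> \<open>Nonnegativity of \<open>inner (T a) a\<close> says that \<open>Q1 a\<close>
    carries at least half of the squared norm of \<open>a\<close>. The constant \<open>1/2\<close>
    is a root-free weakening of \<open>1 / sqrt 2\<close>.\<close>
  have lowA: "1/2 * norm a \<le> norm (Q1 a)" if "a \<in> A" for a
  proof (rule power2_le_imp_le)
    have "(norm a)\<^sup>2 \<le> 2 * (norm (Q1 a))\<^sup>2"
      unfolding power2_norm_eq_inner
      using TA[OF that] inner_decomp[OF AN AN, OF that that] inner_T[OF AN AN, OF that that]
      by linarith
    moreover have "(1/2 * norm a)\<^sup>2 = (norm a)\<^sup>2 / 4" by (simp add: power2_eq_square)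
    ultimately show "(1/2 * norm a)\<^sup>2 \<le> (norm (Q1 a))\<^sup>2"
      using zero_le_power2[of "norm (Q1 a)"] by linarith
  qed simp
  have lowB: "1/2 * norm b \<le> norm (Q2 b)" if "b \<in> B" for b
  proof (rule power2_le_imp_le)
    have "(norm b)\<^sup>2 \<le> 2 * (norm (Q2 b))\<^sup>2"
      unfolding power2_norm_eq_inner
      using TB[OF that] inner_decomp[OF BN BN, OF that that] inner_T[OF BN BN, OF that that]
      by linarith
    moreover have "(1/2 * norm b)\<^sup>2 = (norm b)\<^sup>2 / 4" by (simp add: power2_eq_square)
    ultimately show "(1/2 * norm b)\<^sup>2 \<le> (norm (Q2 b))\<^sup>2"
      using zero_le_power2[of "norm (Q2 b)"] by linarith
  qed simp

  have cF: "complex_vector.subspace (Q ` S)"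
    if "selfadjoint_contraction Q" "complex_vector.subspace S" for Q :: "'a \<Rightarrow> 'a" and S
    unfolding complex_vector.subspace_def
  proof (intro conjI ballI allI)
    show "0 \<in> Q ` S"
      using complex_vector.subspace_0[OF that(2)] sac_zero[OF that(1)] by (metis imageI)
    show "x + y \<in> Q ` S" if "x \<in> Q ` S" "y \<in> Q ` S" for x y
      using that \<open>complex_vector.subspace S\<close> sac_add[OF \<open>selfadjoint_contraction Q\<close>]
      by (metis (no_types, lifting) complex_vector.subspace_add image_iff)
    show "c *\<^sub>C x \<in> Q ` S" if "x \<in> Q ` S" for c x
      using that \<open>complex_vector.subspace S\<close> sac_scaleC[OF \<open>selfadjoint_contraction Q\<close>]
      by (metis (no_types, lifting) complex_vector.subspace_scale image_iff)
  qed
  \<comment> \<open>A bounded linear map that is bounded below on a complete subspace has a complete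
    image, so orthogonal decomposition along the image is available.\<close>
  have F1: "complete (Q1 ` A)"
    using A lowA
    by (intro complete_isometric_image[of "1/2" A Q1] sA sac_bounded_linear[OF Q1(1)])
      (auto simp: complete_csubspace_def)
  have F2: "complete (Q2 ` B)"
    using B lowB
    by (intro complete_isometric_image[of "1/2" B Q2] sB sac_bounded_linear[OF Q2(1)])
      (auto simp: complete_csubspace_def)
  define M1 where "M1 = E1 \<inter> orthogonal_comp (Q1 ` A)"
  define M2 where "M2 = E2 \<inter> orthogonal_comp (Q2 ` B)"
  have M1: "complete_csubspace M1"
    unfolding M1_def by (intro complete_csubspace_orthogonal_comp_Int E1 cF Q1(1) cA)
  have M2: "complete_csubspace M2"
    unfolding M2_def by (intro complete_csubspace_orthogonal_comp_Int E2 cF Q2(1) cB)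
  have sM1: "subspace M1" and sM2: "subspace M2"
    using M1 M2 by (simp_all add: complete_csubspace_def csubspace_imp_subspace)
  have M1_orth: "inner (Q1 a) m = 0" if "a \<in> A" "m \<in> M1" for a m
    using that by (auto simp: M1_def orthogonal_comp_def orthogonal_def)
  have M2_orth: "inner (Q2 b) m = 0" if "b \<in> B" "m \<in> M2" for b m
    using that by (auto simp: M2_def orthogonal_comp_def orthogonal_def)
  have QB: "Q1 b \<in> M1" if "b \<in> B" for b
    using that Q1AB Q1(2) by (auto simp: M1_def orthogonal_comp_def orthogonal_def)
  have QA: "Q2 a \<in> M2" if "a \<in> A" for a
    using that Q2AB Q2(2) by (auto simp: M2_def orthogonal_comp_def orthogonal_def)
  have Q_M1: "Q1 m = m" "Q2 m = 0" if "m \<in> M1" for m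
    using that by (simp_all add: M1_def Q1(3) Q12)
  have Q_M2: "Q1 m = 0" "Q2 m = m" if "m \<in> M2" for m
    using that by (simp_all add: M2_def Q2(3) Q21)

  have normQ1: "norm (Q1 a) \<le> norm (a + x)" if a: "a \<in> A" and x: "Q1 x \<in> M1" for a x
  proof -
    have "norm (Q1 a) \<le> norm (Q1 a + Q1 x)"
    proof (rule power2_le_imp_le)
      show "(norm (Q1 a))\<^sup>2 \<le> (norm (Q1 a + Q1 x))\<^sup>2"
        using M1_orth[OF a x] by (simp add: norm_add_Pythagorean orthogonal_def)
    qed simp
    also have "\<dots> \<le> norm (a + x)" using sac_norm[OF Q1(1), of "a + x"] by (simp add: add1)
    finally show ?thesis .
  qed
  have complete_sum: "complete_csubspace (N + M1)"
  proof -
    have "complete_csubspace (B + M1)"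
    proof (rule complete_csubspace_sum[OF B M1])
      fix b m assume "b \<in> B" "m \<in> M1"
      then have "1/2 * norm b \<le> norm (Q2 (b + m))" using lowB by (simp add: add2 Q_M1)
      then show "1/2 * norm b \<le> norm (b + m)" using sac_norm[OF Q2(1), of "b + m"] by linarith
    qed simp
    then have "complete_csubspace (A + (B + M1))"
    proof (rule complete_csubspace_sum[OF A])
      fix a g assume a: "a \<in> A" and "g \<in> B + M1"
      then obtain b m where "g = b + m" "b \<in> B" "m \<in> M1" by (meson set_plus_elim)
      then have "Q1 g \<in> M1" using QB subspace_add[OF sM1] by (simp add: add1 Q_M1)
      then show "1/2 * norm a \<le> norm (a + g)" using normQ1[OF a] lowA[OF a] by force
    qed simp
    then show ?thesis by (simp add: NAB add.assoc)
  qed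

  have "E1 + E2 \<subseteq> (N + M1) + M2"
  proof
    fix e assume "e \<in> E1 + E2"
    then obtain x y where e: "e = x + y" "x \<in> E1" "y \<in> E2" by (meson set_plus_elim)
    obtain a where a: "a \<in> A" "x - Q1 a \<in> orthogonal_comp (Q1 ` A)"
      using orthogonal_decomposition[OF csubspace_imp_subspace[OF cF[OF Q1(1) cA]] F1, of x] by blast
    obtain b where b: "b \<in> B" "y - Q2 b \<in> orthogonal_comp (Q2 ` B)"
      using orthogonal_decomposition[OF csubspace_imp_subspace[OF cF[OF Q2(1) cB]] F2, of y] by blast
    have "x - Q1 a \<in> M1" "y - Q2 b \<in> M2"
      using a b e Q1(2) Q2(2) sE by (simp_all add: M1_def M2_def subspace_diff)
    then have m: "(x - Q1 a) - Q1 b \<in> M1" "(y - Q2 b) - Q2 a \<in> M2"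
      using QA[OF a(1)] QB[OF b(1)] subspace_diff[OF sM1] subspace_diff[OF sM2] by blast+
    have "e = (a + b) + ((x - Q1 a) - Q1 b) + ((y - Q2 b) - Q2 a)"
      using decomp[OF AN[OF a(1)]] decomp[OF BN[OF b(1)]] e(1) by (simp add: algebra_simps)
    also have "\<dots> \<in> (N + M1) + M2"
      unfolding NAB by (intro set_plus_intro a b m)
    finally show "e \<in> (N + M1) + M2" .
  qed
  moreover have "m1 = 0 \<and> m2 = 0"
    if v: "v \<in> N" and m: "m1 \<in> M1" "m2 \<in> M2" and 0: "v + m1 + m2 = 0" for v m1 m2
  proof -
    obtain a b where ab: "v = a + b" "a \<in> A" "b \<in> B"
      using v NAB by (metis set_plus_elim)
    \<comment> \<open>Under \<open>Q1\<close> the relation becomes \<open>Q1 a\<close> plus a vector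
      orthogonal to it, so \<open>Q1 a\<close>, and by the lower bound \<open>a\<close>, vanishes.
      The same works for \<open>b\<close> under \<open>Q2\<close>.\<close>
    have eq1: "Q1 a + (Q1 b + m1) = 0"
      using arg_cong[OF 0, of Q1] m by (simp add: ab(1) add1 Q_M1 Q_M2 sac_zero[OF Q1(1)] add.assoc)
    have eq2: "Q2 b + (Q2 a + m2) = 0"
      using arg_cong[OF 0, of Q2] m by (simp add: ab(1) add2 Q_M1 Q_M2 sac_zero[OF Q2(1)] ac_simps)
    have "inner (Q1 a) (Q1 a + (Q1 b + m1)) = inner (Q1 a) (Q1 a)"
      using Q1AB[OF ab(2,3)] M1_orth[OF ab(2) m(1)] by (simp add: inner_add_right)
    then have "Q1 a = 0" by (simp add: eq1)
    then have a0: "a = 0" using lowA[OF ab(2)] by simp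
    have "inner (Q2 b) (Q2 b + (Q2 a + m2)) = inner (Q2 b) (Q2 b)"
      using Q2AB[OF ab(2,3)] M2_orth[OF ab(3) m(2)] by (simp add: inner_add_right)
    then have "Q2 b = 0" by (simp add: eq2)
    then have "b = 0" using lowB[OF ab(3)] by simp
    then show ?thesis using a0 eq1 eq2 by (simp add: sac_zero[OF Q1(1)] sac_zero[OF Q2(1)])
  qed
  ultimately show ?thesis
    using M1 M2 complete_sum by (intro exI[of _ M1] exI[of _ M2]) (simp add: M1_def M2_def)
qed

section \<open>Finite orthogonal families of subspaces\<close>

lemma complete_csubspace_zero: "complete_csubspace {0}"
  by (simp add: complete_csubspace_def complex_vector.subspace_single_0 compact_imp_complete)

lemma inner_sum_set_zero:
  fixes E :: "'i \<Rightarrow> 'a::real_inner set"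
  assumes "finite I" "\<And>j y. j \<in> I \<Longrightarrow> y \<in> E j \<Longrightarrow> inner x y = 0" "y \<in> (\<Sum>j\<in>I. E j)"
  shows "inner x y = 0"
  using assms by (auto simp: set_sum_alt inner_sum_right)

lemma complete_csubspace_sum_orthogonal:
  assumes "complete_csubspace A" "complete_csubspace B" "\<And>x y. x \<in> A \<Longrightarrow> y \<in> B \<Longrightarrow> inner x y = 0"
  shows "complete_csubspace (A + B)"
proof (rule complete_csubspace_sum[OF assms(1,2), of 1])
  show "1 * norm x \<le> norm (x + y)" if "x \<in> A" "y \<in> B" for x y
  proof (rule power2_le_imp_le)
    show "(1 * norm x)\<^sup>2 \<le> (norm (x + y))\<^sup>2"
      using assms(3)[OF that] by (simp add: norm_add_Pythagorean orthogonal_def)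
  qed simp
qed simp

lemma complete_csubspace_sum_family:
  assumes "finite I" "\<And>j. j \<in> I \<Longrightarrow> complete_csubspace (E j)"
    and "\<And>i j x y. i \<in> I \<Longrightarrow> j \<in> I \<Longrightarrow> i \<noteq> j \<Longrightarrow> x \<in> E i \<Longrightarrow> y \<in> E j \<Longrightarrow> inner x y = 0"
  shows "complete_csubspace (\<Sum>j\<in>I. E j)"
  using assms
proof (induction I rule: finite_induct)
  case empty
  then show ?case by (simp add: complete_csubspace_zero set_zero)
next
  case (insert i I)
  have "complete_csubspace (\<Sum>j\<in>I. E j)"
    by (rule insert.IH) (use insert.prems in blast)+
  then have "complete_csubspace (E i + (\<Sum>j\<in>I. E j))"
  proof (intro complete_csubspace_sum_orthogonal)
    show "inner x y = 0" if "x \<in> E i" "y \<in> (\<Sum>j\<in>I. E j)" for x y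
      using insert.hyps that by (intro inner_sum_set_zero[OF insert.hyps(1) _ that(2)] insert.prems(2)[of i]) auto
  qed (use insert.prems in auto)
  then show ?case using insert.hyps by simp
qed

text \<open>Induction on the index set: the two-summand case splits off \<open>E i\<close>, and the
  hypothesis is applied to the trace of \<open>N + M1\<close> on the remaining sum. Hence
  \<open>N\<close> must vary in the induction.\<close>

lemma orthogonal_family_complement:
  fixes N :: "'a::complex_inner set"
  assumes "finite I" "\<And>j. j \<in> I \<Longrightarrow> complete_csubspace (E j)"
    and "\<And>i j x y. i \<in> I \<Longrightarrow> j \<in> I \<Longrightarrow> i \<noteq> j \<Longrightarrow> x \<in> E i \<Longrightarrow> y \<in> E j \<Longrightarrow> inner x y = 0"
    and "complete_csubspace N" "N \<subseteq> (\<Sum>j\<in>I. E j)"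
  shows "\<exists>M. (\<forall>j\<in>I. complete_csubspace (M j) \<and> M j \<subseteq> E j) \<and>
    (\<Sum>j\<in>I. E j) \<subseteq> N + (\<Sum>j\<in>I. M j) \<and> N \<inter> (\<Sum>j\<in>I. M j) \<subseteq> {0}"
  using assms
proof (induction I arbitrary: N rule: finite_induct)
  case empty
  have "complex_vector.subspace N" using empty.prems by (simp add: complete_csubspace_def)
  then have "0 \<in> N" by (rule complex_vector.subspace_0)
  then show ?case using empty.prems by (simp add: set_zero)
next
  case (insert i I)
  let ?E = "\<Sum>j\<in>I. E j"
  have csE: "complete_csubspace ?E"
    by (rule complete_csubspace_sum_family[OF insert.hyps(1)]) (use insert.prems in blast)+
  have orth: "inner x y = 0" if "x \<in> E i" "y \<in> ?E" for x y
    using insert.hyps that by (intro inner_sum_set_zero[OF insert.hyps(1) _ that(2)] insert.prems(2)[of i]) auto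
  have "N \<subseteq> E i + ?E" using insert.prems(4) insert.hyps by simp
  then obtain M1 M2 where M1: "complete_csubspace M1" "M1 \<subseteq> E i"
    and M2: "M2 \<subseteq> ?E" and NM1: "complete_csubspace (N + M1)"
    and span: "E i + ?E \<subseteq> (N + M1) + M2"
    and indep: "\<And>v m1 m2. v \<in> N \<Longrightarrow> m1 \<in> M1 \<Longrightarrow> m2 \<in> M2 \<Longrightarrow> v + m1 + m2 = 0 \<Longrightarrow> m1 = 0 \<and> m2 = 0"
    and csM2: "complete_csubspace M2"
    using two_summand_complement[OF insert.prems(1)[of i] csE orth insert.prems(3)] by auto
  have sN: "subspace N" and sM1: "subspace M1" and sM2: "subspace M2"
    using insert.prems(3) M1 csM2 by (auto simp: complete_csubspace_def intro: csubspace_imp_subspace)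
  let ?N = "(N + M1) \<inter> ?E"
  have "complete_csubspace ?N"
    using NM1 csE by (intro complete_csubspace_Int) (auto simp: complete_csubspace_def complete_imp_closed)
  then obtain M where M: "\<And>j. j \<in> I \<Longrightarrow> complete_csubspace (M j)" "\<And>j. j \<in> I \<Longrightarrow> M j \<subseteq> E j"
    and spanM: "?E \<subseteq> ?N + (\<Sum>j\<in>I. M j)" and indepM: "?N \<inter> (\<Sum>j\<in>I. M j) \<subseteq> {0}"
    using insert.IH[of ?N] insert.prems(1,2) by (metis inf_le2 insertCI)
  let ?K = "\<Sum>j\<in>I. M j"
  have KE: "?K \<subseteq> ?E"
    using M(2) insert.hyps(1) by (fastforce simp: set_sum_alt)
  have "E i + ?E \<subseteq> N + (M1 + ?K)"
  proof
    fix e assume "e \<in> E i + ?E"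
    with span have "e \<in> (N + M1) + M2" by blast
    then obtain v m1 m2 where e: "e = v + m1 + m2" and v: "v \<in> N" and m1: "m1 \<in> M1" and m2: "m2 \<in> M2"
      by (auto elim!: set_plus_elim)
    \<comment> \<open>Since \<open>m2\<close> lies in the remaining sum, it is an element of
      \<open>N + M1\<close> plus an element of \<open>?K\<close>; the first part merges with
      \<open>v + m1\<close>.\<close>
    obtain v' m1' k where m2': "m2 = v' + m1' + k" and v': "v' \<in> N" and m1': "m1' \<in> M1" and k: "k \<in> ?K"
    proof -
      have "m2 \<in> ?N + ?K" using m2 M2 spanM by blast
      then show ?thesis using that by (auto elim!: set_plus_elim)
    qed
    have "e = (v + v') + ((m1 + m1') + k)" by (simp add: e m2' ac_simps)
    also have "\<dots> \<in> N + (M1 + ?K)"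
      by (intro set_plus_intro subspace_add[OF sN] subspace_add[OF sM1] v v' m1 m1' k)
    finally show "e \<in> N + (M1 + ?K)" .
  qed
  moreover have "N \<inter> (M1 + ?K) \<subseteq> {0}"
  proof
    fix v assume v: "v \<in> N \<inter> (M1 + ?K)"
    then obtain m k where mk: "v = m + k" "m \<in> M1" "k \<in> ?K" by (meson IntD2 set_plus_elim)
    \<comment> \<open>Thus \<open>k\<close> lies in \<open>N + M1\<close> as well as in the
      remaining sum, hence in \<open>?N\<close>, which meets \<open>?K\<close> only in 0. What
      remains is a relation between \<open>N\<close> and \<open>M1\<close>, settled by
      \<open>indep\<close> with 0 as its third term.\<close>
    have "k = v + (- m)" using mk(1) by simp
    also have "\<dots> \<in> N + M1" using v mk(2) subspace_neg[OF sM1] by (intro set_plus_intro) auto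
    finally have "k \<in> ?N \<inter> ?K" using mk(3) KE by auto
    then have "k = 0" using indepM by blast
    then have "v + (- m) + 0 = 0" using mk(1) by simp
    then have "- m = 0"
      using indep[of v "- m" 0] v mk(2) subspace_neg[OF sM1] subspace_0[OF sM2] by blast
    then show "v \<in> {0}" using mk(1) \<open>k = 0\<close> by simp
  qed
  moreover have "(\<Sum>j\<in>I. (M(i := M1)) j) = ?K"
    using insert.hyps(2) by (intro sum.cong) auto
  ultimately have "(\<Sum>j\<in>insert i I. E j) \<subseteq> N + (\<Sum>j\<in>insert i I. (M(i := M1)) j)"
    "N \<inter> (\<Sum>j\<in>insert i I. (M(i := M1)) j) \<subseteq> {0}"
    using insert.hyps by simp_all
  moreover have "\<forall>j\<in>insert i I. complete_csubspace ((M(i := M1)) j) \<and> (M(i := M1)) j \<subseteq> E j"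
    using M M1 by simp
  ultimately show ?case by blast
qed

section \<open>The Hilbert sum of copies of a space\<close>

text \<open>
  Finitely supported sequences suffice: the space they form is not complete, but sums of finitely many
  complete coordinate subspaces are.
\<close>

typedef (overloaded) 'a direct_sum = "{f :: nat \<Rightarrow> 'a::zero. finite {i. f i \<noteq> 0}}"
  morphisms component Abs_direct_sum
  by (rule exI[of _ "\<lambda>_. 0"]) simp

setup_lifting type_definition_direct_sum

lemma direct_sum_eqI: "(\<And>i. component x i = component y i) \<Longrightarrow> x = y"
  by (simp add: component_inject[symmetric] fun_eq_iff)

lemma finite_component [simp]: "finite {i. component x i \<noteq> 0}"
  using component[of x] by simp

instantiation direct_sum :: (complex_inner) complex_inner
begin

lift_definition zero_direct_sum :: "'a direct_sum" is "\<lambda>_. 0" by simp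

lift_definition plus_direct_sum :: "'a direct_sum \<Rightarrow> 'a direct_sum \<Rightarrow> 'a direct_sum"
  is "\<lambda>f g i. f i + g i"
proof -
  fix f g :: "nat \<Rightarrow> 'a"
  assume "finite {i. f i \<noteq> 0}" "finite {i. g i \<noteq> 0}"
  then have "finite ({i. f i \<noteq> 0} \<union> {i. g i \<noteq> 0})" by simp
  then show "finite {i. f i + g i \<noteq> 0}" by (rule rev_finite_subset) auto
qed

lift_definition uminus_direct_sum :: "'a direct_sum \<Rightarrow> 'a direct_sum" is "\<lambda>f i. - f i" by simp

definition minus_direct_sum :: "'a direct_sum \<Rightarrow> 'a direct_sum \<Rightarrow> 'a direct_sum"
  where "x - y = x + - y" for x y :: "'a direct_sum"

lift_definition scaleC_direct_sum :: "complex \<Rightarrow> 'a direct_sum \<Rightarrow> 'a direct_sum"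
  is "\<lambda>c f i. c *\<^sub>C f i"
  by (rule finite_subset[rotated]) (auto simp: complex_vector.scale_zero_right)

text \<open>The real scaling, and below the real inner product and the norm, are derived from the
  complex structure, so their compatibility with it holds by definition.\<close>

definition scaleR_direct_sum :: "real \<Rightarrow> 'a direct_sum \<Rightarrow> 'a direct_sum"
  where "r *\<^sub>R x = complex_of_real r *\<^sub>C x" for x :: "'a direct_sum"

definition cinner_direct_sum :: "'a direct_sum \<Rightarrow> 'a direct_sum \<Rightarrow> complex"
  where "cinner x y = (\<Sum>i | component x i \<noteq> 0. cinner (component x i) (component y i))"

definition inner_direct_sum :: "'a direct_sum \<Rightarrow> 'a direct_sum \<Rightarrow> real"
  where "inner x y = Re (cinner x y)" for x y :: "'a direct_sum"

definition norm_direct_sum :: "'a direct_sum \<Rightarrow> real"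
  where "norm x = sqrt (inner x x)" for x :: "'a direct_sum"

definition sgn_direct_sum :: "'a direct_sum \<Rightarrow> 'a direct_sum"
  where "sgn x = inverse (norm x) *\<^sub>R x" for x :: "'a direct_sum"

definition dist_direct_sum :: "'a direct_sum \<Rightarrow> 'a direct_sum \<Rightarrow> real"
  where "dist x y = norm (x - y)" for x y :: "'a direct_sum"

definition uniformity_direct_sum :: "('a direct_sum \<times> 'a direct_sum) filter"
  where "uniformity_direct_sum = (INF e\<in>{0<..}. principal {(x, y). dist x y < e})"

definition open_direct_sum :: "'a direct_sum set \<Rightarrow> bool"
  where "open_direct_sum U \<longleftrightarrow> (\<forall>x\<in>U. \<forall>\<^sub>F (x', y) in uniformity. x' = x \<longrightarrow> y \<in> U)"

text \<open>The defining sum runs over the support of the first argument only. Enlarging the index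
  set lets several vectors share one sum, as symmetry and additivity require.\<close>

lemma cinner_direct_sum_superset:
  fixes x y :: "'a direct_sum"
  assumes "finite A" "{i. component x i \<noteq> 0} \<subseteq> A"
  shows "cinner x y = (\<Sum>i\<in>A. cinner (component x i) (component y i))"
proof -
  have "cinner 0 z = 0" for z :: 'a
    using cinner_scaleC_left[of 0 z z] by (simp add: complex_vector.scale_zero_left)
  then show ?thesis
    unfolding cinner_direct_sum_def using assms by (intro sum.mono_neutral_left) auto
qed

lemmas component_simps = zero_direct_sum.rep_eq plus_direct_sum.rep_eq uminus_direct_sum.rep_eq
  scaleC_direct_sum.rep_eq

instance
proof
  fix x y z :: "'a direct_sum" and r s :: real and a b :: complex
  let ?S = "\<lambda>x. {i. component x i \<noteq> (0::'a)}"
  show "x + y + z = x + (y + z)" "x + y = y + x" "0 + x = x" "- x + x = 0"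
    by (rule direct_sum_eqI, simp add: component_simps ac_simps)+
  show "x - y = x + - y" by (rule minus_direct_sum_def)
  show C: "a *\<^sub>C (x + y) = a *\<^sub>C x + a *\<^sub>C y" "(a + b) *\<^sub>C x = a *\<^sub>C x + b *\<^sub>C x"
    "a *\<^sub>C b *\<^sub>C x = (a * b) *\<^sub>C x" "1 *\<^sub>C x = x" for x y :: "'a direct_sum" and a b
    by (rule direct_sum_eqI,
        simp add: component_simps scaleC_add_right scaleC_add_left scaleC_scaleC scaleC_one)+
  show "complex_of_real r *\<^sub>C x = r *\<^sub>R x" by (simp add: scaleR_direct_sum_def)
  show "r *\<^sub>R (x + y) = r *\<^sub>R x + r *\<^sub>R y" "(r + s) *\<^sub>R x = r *\<^sub>R x + s *\<^sub>R x"
    "r *\<^sub>R s *\<^sub>R x = (r * s) *\<^sub>R x" "1 *\<^sub>R x = x"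
    by (simp_all add: scaleR_direct_sum_def C)
  show "dist x y = norm (x - y)" by (rule dist_direct_sum_def)
  show "sgn x = inverse (norm x) *\<^sub>R x" by (rule sgn_direct_sum_def)
  show "uniformity = (INF e\<in>{0<..}. principal {(x, y::'a direct_sum). dist x y < e})"
    by (rule uniformity_direct_sum_def)
  show "open U = (\<forall>x\<in>U. \<forall>\<^sub>F (x', y) in uniformity. x' = x \<longrightarrow> y \<in> U)" for U :: "'a direct_sum set"
    by (rule open_direct_sum_def)
  show "norm x = sqrt (inner x x)" by (rule norm_direct_sum_def)
  show "Re (cinner x y) = inner x y" by (simp add: inner_direct_sum_def)
  show comm: "cinner x y = cnj (cinner y x)" for x y :: "'a direct_sum"
  proof -
    have "cinner x y = (\<Sum>i\<in>?S x \<union> ?S y. cinner (component x i) (component y i))"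
      by (rule cinner_direct_sum_superset) auto
    also have "\<dots> = (\<Sum>i\<in>?S x \<union> ?S y. cnj (cinner (component y i) (component x i)))"
      by (intro sum.cong refl cinner_commute)
    also have "\<dots> = cnj (cinner y x)"
      unfolding cnj_sum[symmetric] by (subst cinner_direct_sum_superset[of "?S x \<union> ?S y" y x]) auto
    finally show ?thesis .
  qed
  show add: "cinner (x + y) z = cinner x z + cinner y z"
  proof -
    have "finite (?S x \<union> ?S y)" "?S (x + y) \<subseteq> ?S x \<union> ?S y" by (auto simp: component_simps)
    then show ?thesis
      using cinner_direct_sum_superset[of "?S x \<union> ?S y" x z] cinner_direct_sum_superset[of "?S x \<union> ?S y" y z]
      by (simp add: cinner_direct_sum_superset[of "?S x \<union> ?S y" "x + y"] component_simps
          cinner_add_left sum.distrib)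
  qed
  show scale: "cinner (a *\<^sub>C x) y = a * cinner x y" for a and x y :: "'a direct_sum"
  proof -
    have "?S (a *\<^sub>C x) \<subseteq> ?S x" by (auto simp: component_simps complex_vector.scale_zero_right)
    then show ?thesis
      using cinner_direct_sum_superset[of "?S x" "a *\<^sub>C x" y] cinner_direct_sum_superset[of "?S x" x y]
      by (simp add: component_simps cinner_scaleC_left sum_distrib_left)
  qed
  show "inner x y = inner y x" by (subst (1 2) inner_direct_sum_def) (subst comm, simp)
  show "inner (x + y) z = inner x z + inner y z" by (simp add: inner_direct_sum_def add)
  show "inner (r *\<^sub>R x) y = r * inner x y" by (simp add: inner_direct_sum_def scaleR_direct_sum_def scale)
  have norm2: "inner x x = (\<Sum>i\<in>?S x. (norm (component x i))\<^sup>2)"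
    by (simp add: inner_direct_sum_def cinner_direct_sum_def cinner_same)
  show "0 \<le> inner x x" unfolding norm2 by (rule sum_nonneg) simp
  show "inner x x = 0 \<longleftrightarrow> x = 0"
  proof
    assume "inner x x = 0"
    then have "\<forall>i\<in>?S x. (norm (component x i))\<^sup>2 = 0"
      unfolding norm2 by (subst (asm) sum_nonneg_eq_0_iff) auto
    then show "x = 0" by (intro direct_sum_eqI) (auto simp: component_simps)
  qed (simp add: inner_direct_sum_def cinner_direct_sum_def component_simps)
qed

end

lemma component_scaleR: "component (r *\<^sub>R x) i = r *\<^sub>R component x i"
  by (simp add: component_simps flip: scaleC_of_real)

lemma inner_direct_sum_eq:
  "inner x y = (\<Sum>i | component x i \<noteq> 0. inner (component x i) (component y i))"
  by (simp add: inner_direct_sum_def cinner_direct_sum_def Re_cinner)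

lemma norm_component_le: "norm (component x i) \<le> norm x"
proof (cases "component x i = 0")
  case False
  have "inner (component x i) (component x i) \<le> inner x x"
    unfolding inner_direct_sum_eq using False by (intro member_le_sum) auto
  then show ?thesis by (simp add: norm_eq_sqrt_inner)
qed simp

lemma bounded_linear_component: "bounded_linear (\<lambda>x. component x i)"
  by (rule bounded_linear_intro[of _ 1])
    (simp_all add: component_simps component_scaleR norm_component_le)

section \<open>Isometric coordinate embeddings\<close>

lift_definition coordinate :: "nat \<Rightarrow> 'a::zero \<Rightarrow> 'a direct_sum"
  is "\<lambda>j x i. if i = j then x else 0"
  by simp

lemma component_coordinate: "component (coordinate j x) i = (if i = j then x else 0)"
  by (simp add: coordinate.rep_eq)

lemma coordinate_scaleC: "coordinate j (c *\<^sub>C x) = c *\<^sub>C coordinate j x"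
  by (rule direct_sum_eqI) (simp add: component_coordinate component_simps complex_vector.scale_zero_right)

lemma inner_coordinate: "inner (coordinate i x) (coordinate j y) = (if i = j then inner x y else 0)"
proof (cases "x = 0")
  case False
  then have "{k. component (coordinate i x) k \<noteq> 0} = {i}" by (auto simp: component_coordinate)
  then show ?thesis by (simp add: inner_direct_sum_eq component_coordinate)
qed (simp add: inner_direct_sum_eq component_coordinate)

lemma norm_coordinate: "norm (coordinate j x) = norm x"
  by (simp add: norm_eq_sqrt_inner inner_coordinate)

lemma bounded_linear_coordinate: "bounded_linear (coordinate j :: 'a::complex_inner \<Rightarrow> 'a direct_sum)"
proof (rule bounded_linear_intro[of _ 1])
  show "coordinate j (x + y) = coordinate j x + coordinate j y" for x y :: 'a
    by (rule direct_sum_eqI) (simp add: component_coordinate component_simps)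
  show "coordinate j (r *\<^sub>R x) = r *\<^sub>R coordinate j x" for r and x :: 'a
    by (simp add: coordinate_scaleC flip: scaleC_of_real)
qed (simp add: norm_coordinate)

lemma component_sum: "component (\<Sum>j\<in>I. f j) k = (\<Sum>j\<in>I. component (f j) k)"
  by (rule linear_sum[OF bounded_linear.linear[OF bounded_linear_component]])

lemma component_sum_coordinate:
  assumes "finite I" "k \<in> I"
  shows "component (\<Sum>j\<in>I. coordinate j (x j)) k = x k"
  using assms by (simp add: component_sum component_coordinate)

lemma complete_csubspace_coordinate:
  assumes "complete_csubspace S"
  shows "complete_csubspace (coordinate j ` S)"
proof -
  have S: "complex_vector.subspace S" "complete S" using assms by (simp_all add: complete_csubspace_def)
  have lin: "linear (coordinate j :: 'a \<Rightarrow> 'a direct_sum)"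
    by (rule bounded_linear.linear[OF bounded_linear_coordinate])
  have "complete (coordinate j ` S)"
    using S(2) by (intro complete_isometric_image[of 1] bounded_linear_coordinate csubspace_imp_subspace S)
      (simp_all add: norm_coordinate)
  moreover have "complex_vector.subspace (coordinate j ` S)"
    unfolding complex_vector.subspace_def
    using complex_vector.subspace_0[OF S(1)] complex_vector.subspace_add[OF S(1)]
      complex_vector.subspace_scale[OF S(1)]
    by (auto simp: image_iff simp flip: coordinate_scaleC linear_add[OF lin])
      (metis lin linear_0)+
  ultimately show ?thesis by (simp add: complete_csubspace_def)
qed

lemma closed_csubspace_vimage:
  assumes "bounded_linear f" "\<And>c x. f (c *\<^sub>C x) = c *\<^sub>C f x" "closed_csubspace S"
  shows "closed_csubspace (f -` S)"
  unfolding closed_csubspace_def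
proof
  have S: "complex_vector.subspace S" "closed S" using assms(3) by (simp_all add: closed_csubspace_def)
  show "closed (f -` S)"
    using S(2) assms(1) by (intro closed_vimage linear_continuous_on)
  show "complex_vector.subspace (f -` S)"
    unfolding complex_vector.subspace_def
    using complex_vector.subspace_0[OF S(1)] complex_vector.subspace_add[OF S(1)]
      complex_vector.subspace_scale[OF S(1)] linear_0[OF bounded_linear.linear[OF assms(1)]]
      linear_add[OF bounded_linear.linear[OF assms(1)]]
    by (simp add: assms(2))
qed

lemma sum_in_set_sum:
  assumes "finite I" "\<And>j. j \<in> I \<Longrightarrow> f j \<in> S j"
  shows "(\<Sum>j\<in>I. f j) \<in> (\<Sum>j\<in>I. S j)"
  using assms by (auto simp: set_sum_alt)

section \<open>Transfer between the direct sum and the original space\<close>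

theorem mainTheorem2:
  fixes H :: "nat \<Rightarrow> 'a::complex_hilbert_space set" and n :: nat
  assumes "n \<ge> 2"
    and "\<forall>j\<in>{1..n}. closed_csubspace (H j)"
  shows "\<exists>M :: nat \<Rightarrow> 'a set.
    (\<forall>j\<in>{2..n}. closed_csubspace (M j) \<and> M j \<subseteq> H j) \<and>
    independent_subspaces {1..n} (M(1 := H 1)) \<and>
    H 1 + (\<Sum>j=2..n. M j) = (\<Sum>j=1..n. H j)"
proof -
  define I where "I = {2..n}"
  have I: "finite I" "1 \<notin> I" "{1..n} = insert 1 I" using assms(1) by (auto simp: I_def)
  have H1: "closed_csubspace (H 1)" and HI: "\<And>j. j \<in> I \<Longrightarrow> closed_csubspace (H j)"
    using assms(2) I(3) by auto
  have sH1: "subspace (H 1)"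
    using H1 by (simp add: closed_csubspace_def csubspace_imp_subspace)
  define E where "E = (\<lambda>j. coordinate j ` H j)"
  have E: "complete_csubspace (E j)" if "j \<in> I" for j
    using HI[OF that] unfolding E_def
    by (intro complete_csubspace_coordinate) (simp add: closed_csubspace_def complete_csubspace_def complete_eq_closed)
  have orth: "inner x y = 0" if "i \<noteq> j" "x \<in> E i" "y \<in> E j" for i j x y
    using that by (auto simp: E_def inner_coordinate)
  \<comment> \<open>The addition map from tuples to the original space. The tuples in the sum of the
    \<open>E j\<close> that it sends into \<open>H 1\<close> form the subspace \<open>N\<close> to
    be complemented.\<close>
  define total where "total = (\<lambda>x::'a direct_sum. \<Sum>k\<in>I. component x k)"
  have total: "bounded_linear total"
    unfolding total_def by (intro bounded_linear_sum bounded_linear_component)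
  have total_scaleC: "total (c *\<^sub>C x) = c *\<^sub>C total x" for c x
    by (simp add: total_def component_simps complex_vector.scale_sum_right)
  note total_add = linear_add[OF bounded_linear.linear[OF total]]
  have total_coordinate: "total (\<Sum>j\<in>I. coordinate j (x j)) = (\<Sum>j\<in>I. x j)" for x
    unfolding total_def by (intro sum.cong refl component_sum_coordinate I(1))
  define N where "N = (\<Sum>j\<in>I. E j) \<inter> total -` H 1"
  have "complete_csubspace (\<Sum>j\<in>I. E j)"
    using I(1) E by (rule complete_csubspace_sum_family) (auto intro: orth)
  then have "complete_csubspace N"
    using closed_csubspace_vimage[OF total total_scaleC H1] unfolding N_def
    by (intro complete_csubspace_Int) (auto simp: closed_csubspace_def)
  then have "\<exists>K. (\<forall>j\<in>I. complete_csubspace (K j) \<and> K j \<subseteq> E j) \<and>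
    (\<Sum>j\<in>I. E j) \<subseteq> N + (\<Sum>j\<in>I. K j) \<and> N \<inter> (\<Sum>j\<in>I. K j) \<subseteq> {0}"
    by (intro orthogonal_family_complement I(1) E) (auto simp: N_def intro: orth)
  then obtain K where K': "\<forall>j\<in>I. complete_csubspace (K j) \<and> K j \<subseteq> E j"
    and span: "(\<Sum>j\<in>I. E j) \<subseteq> N + (\<Sum>j\<in>I. K j)" and indep: "N \<inter> (\<Sum>j\<in>I. K j) \<subseteq> {0}"
    by (elim exE conjE)
  have K: "complete_csubspace (K j)" "K j \<subseteq> E j" if "j \<in> I" for j
    using K' that by simp_all
  \<comment> \<open>As \<open>K j\<close> lies in the image of \<open>H j\<close> under the
    injective map \<open>coordinate j\<close>, its preimage \<open>M j\<close> is a copy of it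
    inside \<open>H j\<close>.\<close>
  define M where "M = (\<lambda>j. coordinate j -` K j)"
  have M: "closed_csubspace (M j)" if "j \<in> I" for j
    using K(1)[OF that] unfolding M_def
    by (intro closed_csubspace_vimage bounded_linear_coordinate coordinate_scaleC)
      (simp add: closed_csubspace_def complete_csubspace_def complete_imp_closed)
  have MH: "M j \<subseteq> H j" if j: "j \<in> I" for j
  proof
    fix x assume "x \<in> M j"
    then obtain h where h: "h \<in> H j" "coordinate j x = coordinate j h"
      using K(2)[OF j] by (auto simp: M_def E_def)
    have "x = h" using arg_cong[OF h(2), of "\<lambda>z. component z j"] by (simp add: component_coordinate)
    then show "x \<in> H j" using h(1) by simp
  qed

  have "independent_subspaces {1..n} (M(1 := H 1))"
    unfolding independent_subspaces_def
  proof (intro allI impI)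
    fix x assume x: "(\<forall>j\<in>{1..n}. x j \<in> (M(1 := H 1)) j) \<and> (\<Sum>j = 1..n. x j) = 0"
    have x1: "x 1 \<in> H 1" and xM: "\<And>j. j \<in> I \<Longrightarrow> x j \<in> M j"
      using x I(2,3) by (auto split: if_splits)
    have sum0: "x 1 + (\<Sum>j\<in>I. x j) = 0" using x I by simp
    \<comment> \<open>The tuple of the entries with index in \<open>I\<close>. Its total is
      \<open>- x 1\<close>, an element of \<open>H 1\<close>, so it lies in \<open>N\<close> as well
      as in the complement and is therefore 0.\<close>
    define z where "z = (\<Sum>j\<in>I. coordinate j (x j))"
    have "z \<in> (\<Sum>j\<in>I. K j)"
      unfolding z_def using xM by (intro sum_in_set_sum I(1)) (auto simp: M_def)
    moreover have "z \<in> (\<Sum>j\<in>I. E j)"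
      unfolding z_def using xM MH by (intro sum_in_set_sum I(1)) (auto simp: E_def)
    moreover have "total z = - x 1"
      using sum0 by (simp add: z_def total_coordinate eq_neg_iff_add_eq_0 add.commute)
    then have "total z \<in> H 1" using subspace_neg[OF sH1 x1] by simp
    ultimately have "z = 0" using indep by (auto simp: N_def)
    then have "x j = 0" if "j \<in> I" for j
      using component_sum_coordinate[OF I(1) that, of x] by (simp add: z_def component_simps)
    then show "\<forall>j\<in>{1..n}. x j = 0" using sum0 I(3) by simp
  qed
  moreover have "H 1 + (\<Sum>j\<in>I. M j) = H 1 + (\<Sum>j\<in>I. H j)"
  proof
    have "(\<Sum>j\<in>I. M j) \<subseteq> (\<Sum>j\<in>I. H j)"
      using MH I(1) by (fastforce simp: set_sum_alt)
    then show "H 1 + (\<Sum>j\<in>I. M j) \<subseteq> H 1 + (\<Sum>j\<in>I. H j)" by (rule set_plus_mono2[OF subset_refl])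
    show "H 1 + (\<Sum>j\<in>I. H j) \<subseteq> H 1 + (\<Sum>j\<in>I. M j)"
    proof
      fix w assume "w \<in> H 1 + (\<Sum>j\<in>I. H j)"
      then obtain h1 g where g: "w = h1 + g" "h1 \<in> H 1" "g \<in> (\<Sum>j\<in>I. H j)"
        by (rule set_plus_elim)
      from g(3) obtain h where h: "g = (\<Sum>j\<in>I. h j)" "\<And>j. j \<in> I \<Longrightarrow> h j \<in> H j"
        using I(1) by (auto simp: set_sum_alt)
      \<comment> \<open>The vector \<open>g\<close> is lifted to a tuple and split along
        \<open>N\<close> and the sum of the \<open>K j\<close>. Applying \<open>total\<close> turns
        the part in \<open>N\<close> into an element of \<open>H 1\<close>, which is absorbed by
        \<open>h1\<close>.\<close>
      have "(\<Sum>j\<in>I. coordinate j (h j)) \<in> (\<Sum>j\<in>I. E j)"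
        using h(2) by (intro sum_in_set_sum I(1)) (auto simp: E_def)
      with span have "(\<Sum>j\<in>I. coordinate j (h j)) \<in> N + (\<Sum>j\<in>I. K j)" by blast
      then obtain v k where vk: "(\<Sum>j\<in>I. coordinate j (h j)) = v + k" "v \<in> N" "k \<in> (\<Sum>j\<in>I. K j)"
        by (rule set_plus_elim)
      from vk(3) obtain s where s: "k = (\<Sum>j\<in>I. s j)" "\<And>j. j \<in> I \<Longrightarrow> s j \<in> K j"
        using I(1) by (auto simp: set_sum_alt)
      have "\<forall>j\<in>I. \<exists>m. s j = coordinate j m" using s(2) K(2) by (fastforce simp: E_def)
      then obtain m where m: "\<And>j. j \<in> I \<Longrightarrow> s j = coordinate j (m j)" by metis
      have "k = (\<Sum>j\<in>I. coordinate j (m j))" using s(1) m by simp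
      then have "(\<Sum>j\<in>I. h j) = total v + (\<Sum>j\<in>I. m j)"
        using arg_cong[OF vk(1), of total] by (simp add: total_add total_coordinate)
      then have "w = (h1 + total v) + (\<Sum>j\<in>I. m j)" by (simp add: g(1) h(1) add.assoc)
      moreover have "h1 + total v \<in> H 1"
        using g(2) vk(2) by (intro subspace_add[OF sH1]) (auto simp: N_def)
      moreover have "(\<Sum>j\<in>I. m j) \<in> (\<Sum>j\<in>I. M j)"
        using s(2) m by (intro sum_in_set_sum I(1)) (simp add: M_def)
      ultimately show "w \<in> H 1 + (\<Sum>j\<in>I. M j)" by (simp add: set_plus_intro)
    qed
  qed
  ultimately show ?thesis
    using M MH I by (intro exI[of _ M]) (simp add: I_def)
qed

end
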